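(* Let $\Gamma=N+S$ and suppose $X(\Gamma)$ has genus $g\ge1$ and that $i\infty$ is not a Weierstrass point of $X(\Gamma)$. Assume that the Fourier coefficients $a_\Gamma(\cdot,\cdot)$ are all integers. If $p$ is a prime with $p>g$, then for any positive integers $r$, $n$ and $m>g$ with $p\nmid m$ and $p\nmid n$, $$a_\Gamma(mp^r,n)+\sum_{l=1}^g a_\Gamma(m,-l)\,a_\Gamma(lp^r,n)\equiv0\pmod{p^r}.$$
   Context: For a positive integer $N$ and a set $S$ of exact divisors $Q$ of $N$ ($Q\mid N$, $\gcd(Q,N/Q)=1$), $\Gamma=N+S$ is the subgroup of $\mathrm{PSL}_2(\mathbb R)$ generated by $\Gamma_0(N)$ and the Atkin-Lehner involutions $W_{Q,N}=\begin{pmatrix}Qx&y\\ Nz&Qw\end{pmatrix}$ ($x,y,z,w\in\mathbb Z$, determinant $Q$), $Q\in S$. $X(\Gamma)$ is the compactified modular curve $\Gamma\backslash(\mathbb H\cup\mathbb Q\cup\{i\infty\})$; $q=e^{2\pi i\tau}$. $M_0^{!,\infty}(\Gamma)$ is the space of weakly holomorphic modular functions on $\Gamma$ whose poles are supported only at the cusp $i\infty$ and which are holomorphic at the other cusps. Since $i\infty$ is not a Weierstrass point, for each $m\ge g+1$ there is a unique $$f_{\Gamma,m}=q^{-m}+\sum_{l=1}^g a_\Gamma(m,-l)q^{-l}+\sum_{n\ge1}a_\Gamma(m,n)q^n\in M_0^{!,\infty}(\Gamma)$$ (zero constant term). For $1\le m\le g$ put $f_{\Gamma,m}=0$, with $a_\Gamma(m,-m)=-1$,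 $a_\Gamma(m,-l)=0$ for $1\le l\le g$, $l\ne m$, and $a_\Gamma(m,n)=0$ for $n\ge1$. *)

theory Defs
  imports
    "HOL-Complex_Analysis.Complex_Analysis"
    "HOL-Homology.Homology"
    "HOL-Number_Theory.Cong"
begin

definition mat2 :: "real \<Rightarrow> real \<Rightarrow> real \<Rightarrow> real \<Rightarrow> real ^ 2 ^ 2" where
  "mat2 a b c d = vector [vector [a, b], vector [c, d]]"

definition SL2R :: "(real ^ 2 ^ 2) monoid" where
  "SL2R = \<lparr>carrier = {A. det A = 1}, monoid.mult = (**), one = mat 1\<rparr>"

definition Gamma0 :: "nat \<Rightarrow> (real ^ 2 ^ 2) set" where
  "Gamma0 N = {mat2 (of_int a) (of_int b) (of_int c) (of_int d) | a b c d :: int.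
     a * d - b * c = 1 \<and> int N dvd c}"

text \<open>The matrices \<open>(Qx, y; Nz, Qw)\<close> of determinant \<open>Q\<close>, divided by \<open>sqrt Q\<close> to lie in \<open>SL\<^sub>2(\<real>)\<close>.\<close>

definition Atkin_Lehner :: "nat \<Rightarrow> nat \<Rightarrow> (real ^ 2 ^ 2) set" where
  "Atkin_Lehner N Q =
     {mat2 (of_int (int Q * x) / sqrt (real Q)) (of_int y / sqrt (real Q))
           (of_int (int N * z) / sqrt (real Q)) (of_int (int Q * w) / sqrt (real Q))
      | x y z w :: int. (int Q * x) * (int Q * w) - y * (int N * z) = int Q}"

definition exact_divisor :: "nat \<Rightarrow> nat \<Rightarrow> bool" where
  "exact_divisor Q N \<longleftrightarrow> Q dvd N \<and> coprime Q (N div Q)"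

text \<open>
  The full preimage in \<open>SL\<^sub>2(\<real>)\<close> of the subgroup \<open>N + S\<close> of \<open>PSL\<^sub>2(\<real>)\<close>: it contains
  \<open>- mat 1\<close>, which is an element of \<open>Gamma0 N\<close>, and \<open>A\<close> and \<open>- A\<close> act in the same way.
\<close>

definition N_plus_S :: "nat \<Rightarrow> nat set \<Rightarrow> (real ^ 2 ^ 2) set" where
  "N_plus_S N S = generate SL2R (Gamma0 N \<union> (\<Union>Q\<in>S. Atkin_Lehner N Q))"

definition upper_half_plane :: "complex set" where
  "upper_half_plane = {z. Im z > 0}"

definition mobius :: "real ^ 2 ^ 2 \<Rightarrow> complex \<Rightarrow> complex" where
  "mobius A z = (of_real (A $ 1 $ 1) * z + of_real (A $ 1 $ 2)) /
                (of_real (A $ 2 $ 1) * z + of_real (A $ 2 $ 2))"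

text \<open>The Riemann sphere is modelled by \<open>complex option\<close>; \<open>None\<close> is the point at infinity.\<close>

fun mobius_ext :: "real ^ 2 ^ 2 \<Rightarrow> complex option \<Rightarrow> complex option" where
  "mobius_ext A None =
     (if A $ 2 $ 1 = 0 then None else Some (of_real (A $ 1 $ 1 / A $ 2 $ 1)))"
| "mobius_ext A (Some z) =
     (if of_real (A $ 2 $ 1) * z + of_real (A $ 2 $ 2) = 0 then None else Some (mobius A z))"

definition extended_plane :: "complex option set" where
  "extended_plane = Some ` upper_half_plane \<union> Some ` \<rat> \<union> {None}"

definition orbit_of :: "(real ^ 2 ^ 2) set \<Rightarrow> complex option \<Rightarrow> complex option set" where
  "orbit_of G s = (\<lambda>A. mobius_ext A s) ` G"

text \<open>
  Neighbourhoods of \<open>None\<close> contain a half-plane \<open>Im z > c\<close>; neighbourhoods of a rational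
  cusp \<open>x\<close> contain an open disc in the upper half-plane tangent to the real axis at \<open>x\<close>.
\<close>

definition open_extended :: "complex option set \<Rightarrow> bool" where
  "open_extended U \<longleftrightarrow>
     U \<subseteq> extended_plane \<and>
     open {z \<in> upper_half_plane. Some z \<in> U} \<and>
     (None \<in> U \<longrightarrow> (\<exists>c>0. \<forall>z. Im z > c \<longrightarrow> Some z \<in> U)) \<and>
     (\<forall>x::real. Some (of_real x) \<in> U \<longrightarrow> (\<exists>r>0. \<forall>z\<in>ball (Complex x r) r. Some z \<in> U))"

definition extended_plane_topology :: "complex option topology" where
  "extended_plane_topology = topology open_extended"

text \<open>Points of \<open>X(\<Gamma>)\<close> are orbits; it carries the quotient topology.\<close>

definition modular_curve_points :: "(real ^ 2 ^ 2) set \<Rightarrow> complex option set set" where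
  "modular_curve_points G = orbit_of G ` extended_plane"

definition modular_curve :: "(real ^ 2 ^ 2) set \<Rightarrow> complex option set topology" where
  "modular_curve G = topology (\<lambda>V. V \<subseteq> modular_curve_points G \<and>
     openin extended_plane_topology {s \<in> extended_plane. orbit_of G s \<in> V})"

lemma istopology_open_extended: "istopology open_extended"
  unfolding istopology_def
proof (intro conjI allI impI)
  fix U V assume U: "open_extended U" and V: "open_extended V"
  have "{z \<in> upper_half_plane. Some z \<in> U \<inter> V} =
        {z \<in> upper_half_plane. Some z \<in> U} \<inter> {z \<in> upper_half_plane. Some z \<in> V}"
    by auto
  then have 1: "open {z \<in> upper_half_plane. Some z \<in> U \<inter> V}"
    using U V by (auto simp: open_extended_def)
  have 2: "\<exists>c>0. \<forall>z. Im z > c \<longrightarrow> Some z \<in> U \<inter> V" if *: "None \<in> U \<inter> V"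
  proof -
    obtain c d where "c > 0" "\<forall>z. Im z > c \<longrightarrow> Some z \<in> U" "d > 0" "\<forall>z. Im z > d \<longrightarrow> Some z \<in> V"
      using U V * unfolding open_extended_def by blast
    then show ?thesis by (intro exI[of _ "max c d"]) auto
  qed
  have 3: "\<exists>r>0. \<forall>z\<in>ball (Complex x r) r. Some z \<in> U \<inter> V"
    if *: "Some (of_real x) \<in> U \<inter> V" for x
  proof -
    obtain r s where r: "r > 0" "\<forall>z\<in>ball (Complex x r) r. Some z \<in> U"
      and s: "s > 0" "\<forall>z\<in>ball (Complex x s) s. Some z \<in> V"
      using U V * unfolding open_extended_def by blast
    have sub: "ball (Complex x t) t \<subseteq> ball (Complex x u) u" if "0 < t" "t \<le> u" for t u
    proof
      fix z assume "z \<in> ball (Complex x t) t"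
      moreover have "Complex x u - Complex x t = Complex 0 (u - t)"
        by (simp add: complex_eq_iff)
      then have "dist (Complex x u) (Complex x t) = u - t"
        using that by (simp add: dist_norm cmod_def)
      ultimately show "z \<in> ball (Complex x u) u"
        using dist_triangle[of "Complex x u" z "Complex x t"] by simp
    qed
    show ?thesis
    proof (intro exI conjI ballI)
      show "min r s > 0" using r s by simp
    next
      fix z assume "z \<in> ball (Complex x (min r s)) (min r s)"
      then have "z \<in> ball (Complex x r) r" "z \<in> ball (Complex x s) s"
        using sub[of "min r s" r] sub[of "min r s" s] r(1) s(1) by (meson min.cobounded1 min.cobounded2 min_less_iff_conj subsetD)+
      then show "Some z \<in> U \<inter> V" using r s by blast
    qed
  qed
  show "open_extended (U \<inter> V)"
    using U 1 2 3 unfolding open_extended_def by blast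
next
  fix \<K> assume K: "\<forall>U\<in>\<K>. open_extended U"
  have "{z \<in> upper_half_plane. Some z \<in> \<Union>\<K>} = (\<Union>U\<in>\<K>. {z \<in> upper_half_plane. Some z \<in> U})"
    by auto
  then have "open {z \<in> upper_half_plane. Some z \<in> \<Union>\<K>}"
    using K by (auto simp: open_extended_def)
  then show "open_extended (\<Union>\<K>)"
    using K unfolding open_extended_def Union_iff
    by (smt (verit) Sup_least UnionI)
qed

lemma openin_extended_plane_topology [simp]:
  "openin extended_plane_topology U \<longleftrightarrow> open_extended U"
  by (simp add: extended_plane_topology_def istopology_open_extended)

lemma openin_modular_curve:
  "openin (modular_curve G) V \<longleftrightarrow>
     V \<subseteq> modular_curve_points G \<and>
     openin extended_plane_topology {s \<in> extended_plane. orbit_of G s \<in> V}"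
proof -
  have "istopology (\<lambda>V. V \<subseteq> modular_curve_points G \<and>
     openin extended_plane_topology {s \<in> extended_plane. orbit_of G s \<in> V})"
    unfolding istopology_def
  proof (intro conjI allI impI)
    fix \<K> :: "complex option set set set"
    assume K: "\<forall>V\<in>\<K>. V \<subseteq> modular_curve_points G \<and>
      openin extended_plane_topology {s \<in> extended_plane. orbit_of G s \<in> V}"
    have "{s \<in> extended_plane. orbit_of G s \<in> \<Union>\<K>} =
          (\<Union>V\<in>\<K>. {s \<in> extended_plane. orbit_of G s \<in> V})"
      by auto
    then show "openin extended_plane_topology {s \<in> extended_plane. orbit_of G s \<in> \<Union>\<K>}"
      using K by (simp only:) (rule openin_Union, blast)
    show "\<Union>\<K> \<subseteq> modular_curve_points G" using K by blast
  next
    fix V W :: "complex option set set"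
    assume "V \<subseteq> modular_curve_points G \<and>
      openin extended_plane_topology {s \<in> extended_plane. orbit_of G s \<in> V}"
     "W \<subseteq> modular_curve_points G \<and>
      openin extended_plane_topology {s \<in> extended_plane. orbit_of G s \<in> W}"
    moreover have "{s \<in> extended_plane. orbit_of G s \<in> V \<inter> W} =
       {s \<in> extended_plane. orbit_of G s \<in> V} \<inter> {s \<in> extended_plane. orbit_of G s \<in> W}"
      by auto
    ultimately show "openin extended_plane_topology {s \<in> extended_plane. orbit_of G s \<in> V \<inter> W}"
      using openin_Int by (simp only:) blast
  qed blast
  then show ?thesis by (simp add: modular_curve_def)
qed

text \<open>The genus of a closed orientable surface is half the rank of its first homology group.\<close>

definition has_genus :: "'a topology \<Rightarrow> nat \<Rightarrow> bool" where
  "has_genus X g \<longleftrightarrow> homology_group 1 X \<cong> free_Abelian_group {..<2 * g}"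

text \<open>
  \<open>f = \<Sum>\<^sub>k L\<^sub>k q\<^sup>k\<close> with \<open>q = exp (2 \<pi> i \<tau>)\<close>. As \<open>L\<close> is a formal Laurent series, this says in
  particular that \<open>f\<close> is meromorphic at infinity. (The translation \<open>\<tau> \<mapsto> \<tau> + 1\<close> generates
  the stabiliser of infinity in \<open>N + S\<close> modulo sign.)
\<close>

definition has_q_expansion :: "(complex \<Rightarrow> complex) \<Rightarrow> complex fls \<Rightarrow> bool" where
  "has_q_expansion f L \<longleftrightarrow>
     (\<exists>F. F has_laurent_expansion L \<and>
          (\<forall>\<tau>\<in>upper_half_plane. f \<tau> = F (exp (2 * of_real pi * \<i> * \<tau>))))"

text \<open>
  Holomorphy of \<open>f\<close> at the cusp \<open>A \<infinity>\<close>, for \<open>A\<close> in \<open>SL\<^sub>2(\<int>) = Gamma0 1\<close>: \<open>f \<circ> A\<close> has an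
  expansion without negative powers in \<open>exp (2 \<pi> i \<tau> / h)\<close> for some \<open>h > 0\<close>.
\<close>

definition holomorphic_at_cusp :: "(complex \<Rightarrow> complex) \<Rightarrow> real ^ 2 ^ 2 \<Rightarrow> bool" where
  "holomorphic_at_cusp f A \<longleftrightarrow>
     (\<exists>h::real. h > 0 \<and> (\<exists>F. F analytic_on {0} \<and>
        (\<forall>\<tau>\<in>upper_half_plane.
           f (mobius A \<tau>) = F (exp (2 * of_real pi * \<i> * \<tau> / of_real h)))))"

text \<open>The space of weight-0 functions \<open>M\<^sub>0\<^sup>!\<^sup>,\<^sup>\<infinity>(\<Gamma>)\<close>; only the values on the upper half-plane matter.\<close>

definition M0_inf :: "(real ^ 2 ^ 2) set \<Rightarrow> (complex \<Rightarrow> complex) set" where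
  "M0_inf G = {f.
     f holomorphic_on upper_half_plane \<and>
     (\<forall>A\<in>G. \<forall>\<tau>\<in>upper_half_plane. f (mobius A \<tau>) = f \<tau>) \<and>
     (\<exists>L. has_q_expansion f L) \<and>
     (\<forall>A\<in>Gamma0 1. mobius_ext A None \<notin> orbit_of G None \<longrightarrow> holomorphic_at_cusp f A)}"

text \<open>
  A point of a compact Riemann surface of genus \<open>g\<close> is a Weierstrass point iff some nonconstant
  meromorphic function has a pole of order at most \<open>g\<close> there and no other pole. The
  functions on \<open>X(\<Gamma>)\<close> with no pole outside infinity are those of \<open>M0_inf\<close>.
\<close>

definition infinity_Weierstrass_point :: "(real ^ 2 ^ 2) set \<Rightarrow> nat \<Rightarrow> bool" where
  "infinity_Weierstrass_point G g \<longleftrightarrow>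
     (\<exists>f\<in>M0_inf G. \<exists>L. has_q_expansion f L \<and> fls_subdegree L \<ge> - int g \<and>
        \<not> f constant_on upper_half_plane)"

text \<open>
  \<open>f\<close> is the reduced function \<open>f\<^sub>\<Gamma>\<^sub>,\<^sub>m\<close> and \<open>a k\<close> is \<open>a\<^sub>\<Gamma>(m, k)\<close>, where \<open>k\<close> ranges over
  \<open>- g \<le> k \<le> - 1\<close> and \<open>k \<ge> 1\<close>; the other values of \<open>a\<close> are irrelevant. The case \<open>m \<le> g\<close>
  is a convention. For \<open>m > g\<close>, \<open>f\<close> is unique on the upper half-plane when infinity is not a
  Weierstrass point.
\<close>

definition is_reduced_function ::
  "(real ^ 2 ^ 2) set \<Rightarrow> nat \<Rightarrow> nat \<Rightarrow> (complex \<Rightarrow> complex) \<Rightarrow> (int \<Rightarrow> complex) \<Rightarrow> bool" where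
  "is_reduced_function G g m f a \<longleftrightarrow>
     (if m > g then
        f \<in> M0_inf G \<and>
        (\<exists>L. has_q_expansion f L \<and>
           (\<forall>k. fls_nth L k =
              (if k = - int m then 1
               else if (- int g \<le> k \<and> k \<le> - 1) \<or> k \<ge> 1 then a k
               else 0)))
      else
        (\<forall>\<tau>\<in>upper_half_plane. f \<tau> = 0) \<and>
        a (- int m) = - 1 \<and>
        (\<forall>l\<in>{1..g}. l \<noteq> m \<longrightarrow> a (- int l) = 0) \<and>
        (\<forall>n\<ge>1. a n = 0))"

end

theory Submission
  imports Defs
begin

text \<open>
  Put \<open>P = p\<^sup>r\<close> and \<open>F = f\<^sub>m\<close>. The elements of norm \<open>P\<close> in the Eichler order of level \<open>N\<close> form a
  set \<open>\<Delta>\<close>, and \<open>\<Gamma>\<close> normalizes this order. Hence \<open>G(\<tau>) = \<Sum> F(x \<tau>)\<close>, summed over \<open>x\<close> in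
  \<open>\<Gamma>\<^sub>0(N) \ \<Delta>\<close>, is \<open>\<Gamma>\<close>-invariant, whether or not \<open>p\<close> divides \<open>N\<close>. At a cusp, the classes \<open>x\<close>
  that meet a pole of \<open>F\<close> are permuted by the conjugates of the translations by \<open>i / p\<close> that fix
  this pole, with the only exception of the class of \<open>diag(P, 1)\<close> at infinity. Since the pole
  exponents of \<open>F\<close> are prime to \<open>p\<close> (this uses \<open>p > g\<close>), averaging over these translations
  removes the poles. So \<open>G\<close> lies in \<open>M0_inf \<Gamma>\<close> and has the principal part of \<open>F(P \<tau>)\<close>, and
  therefore \<open>G - f\<^bsub>m P\<^esub> - \<Sum>\<^sub>l a(m, -l) f\<^bsub>l P\<^esub>\<close> has a pole of order at most \<open>g\<close> at infinity and is
  constant. On the other hand, the classes of \<open>\<Delta>\<close> other than those of the matrices \<open>(1, b; 0, P)\<close>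
  contribute a function invariant under \<open>\<tau> \<mapsto> \<tau> + 1 / p\<close>, so that the \<open>n\<close>-th coefficient of \<open>G\<close> is
  \<open>P a(m, n P)\<close> for \<open>n\<close> prime to \<open>p\<close>. The left-hand side of the congruence thus equals
  \<open>P a(m, n P)\<close>.
\<close>

section \<open>Functions of the nome\<close>

definition nome :: "complex \<Rightarrow> complex" where
  "nome \<tau> = exp (2 * of_real pi * \<i> * \<tau>)"

abbreviation at_ioo :: "complex filter" where
  "at_ioo \<equiv> filtercomap Im at_top"

lemma nome_nonzero [simp]: "nome \<tau> \<noteq> 0"
  by (simp add: nome_def)

lemma norm_nome: "norm (nome \<tau>) = exp (- (2 * pi * Im \<tau>))"
  by (simp add: nome_def)

lemma norm_nome_less_1: "\<tau> \<in> upper_half_plane \<Longrightarrow> norm (nome \<tau>) < 1"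
  by (simp add: norm_nome upper_half_plane_def)

lemma nome_add: "nome (\<tau> + w) = nome \<tau> * nome w"
  by (simp add: nome_def exp_add [symmetric] algebra_simps)

lemma nome_mult_int: "nome (of_int k * \<tau>) = nome \<tau> powi k"
proof -
  have "nome (of_int k * \<tau>) = exp (of_int k * (2 * of_real pi * \<i> * \<tau>))"
    by (simp add: nome_def mult_ac)
  also have "\<dots> = nome \<tau> powi k"
    by (simp only: exp_power_int nome_def)
  finally show ?thesis .
qed

lemma nome_of_int [simp]: "nome (of_int k) = 1"
  using exp_integer_2pi[of "of_int k"] by (simp add: nome_def mult_ac)

lemma nome_mult_nat: "nome (of_nat k * \<tau>) = nome \<tau> ^ k"
  using nome_mult_int[of "int k" \<tau>] by simp

lemma exists_nome:
  assumes "q \<noteq> 0" "norm q < 1"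
  obtains \<tau> where "\<tau> \<in> upper_half_plane" "nome \<tau> = q"
proof -
  define \<tau> where "\<tau> = Ln q / (2 * of_real pi * \<i>)"
  have q: "nome \<tau> = q"
    using assms by (simp add: nome_def \<tau>_def)
  moreover have "exp (- (2 * pi * Im \<tau>)) < exp 0"
    using assms q norm_nome[of \<tau>] by simp
  then have "Im \<tau> > 0"
    by (simp add: zero_less_mult_iff)
  ultimately show ?thesis
    using that by (simp add: upper_half_plane_def)
qed

lemma bigo_ioo_1_iff:
  "(f :: complex \<Rightarrow> complex) \<in> O[at_ioo](\<lambda>_. 1) \<longleftrightarrow> (\<exists>c B. \<forall>\<tau>. Im \<tau> > c \<longrightarrow> norm (f \<tau>) \<le> B)"
proof
  assume "f \<in> O[at_ioo](\<lambda>_. 1)"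
  then obtain B where "eventually (\<lambda>\<tau>. norm (f \<tau>) \<le> B * norm (1::complex)) at_ioo"
    by (elim landau_o.bigE)
  then show "\<exists>c B. \<forall>\<tau>. Im \<tau> > c \<longrightarrow> norm (f \<tau>) \<le> B"
    unfolding eventually_filtercomap_at_top_dense by auto
next
  assume "\<exists>c B. \<forall>\<tau>. Im \<tau> > c \<longrightarrow> norm (f \<tau>) \<le> B"
  then obtain c B where "\<forall>\<tau>. Im \<tau> > c \<longrightarrow> norm (f \<tau>) \<le> B" by blast
  then have "eventually (\<lambda>\<tau>. norm (f \<tau>) \<le> B * norm (1::complex)) at_ioo"
    unfolding eventually_filtercomap_at_top_dense by auto
  then show "f \<in> O[at_ioo](\<lambda>_. 1)" by (rule bigoI)
qed

lemma eventually_upper_half_plane: "eventually (\<lambda>\<tau>. \<tau> \<in> upper_half_plane) at_ioo"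
  unfolding eventually_filtercomap_at_top_dense upper_half_plane_def by blast

section \<open>Periodic functions on the upper half-plane as functions on the disc\<close>

lemma periodic_int:
  assumes per: "\<And>\<tau>. \<tau> \<in> upper_half_plane \<Longrightarrow> f (\<tau> + of_real w) = f \<tau>"
    and "\<tau> \<in> upper_half_plane"
  shows "f (\<tau> + of_int k * of_real w) = f \<tau>"
proof (induction k rule: int_induct [where k = 0])
  case base
  then show ?case by simp
next
  case (step1 i)
  have "\<tau> + of_int i * of_real w \<in> upper_half_plane"
    using assms by (simp add: upper_half_plane_def)
  from per[OF this] step1 show ?case by (simp add: algebra_simps)
next
  case (step2 i)
  have "\<tau> + of_int (i - 1) * of_real w \<in> upper_half_plane"
    using assms by (simp add: upper_half_plane_def)
  from per[OF this] step2 show ?case by (simp add: algebra_simps)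
qed

text \<open>Composing \<open>f\<close> with a logarithm gives a function on the punctured disc that
  does not depend on the branch and is therefore holomorphic there; boundedness near 0 makes the
  singularity removable.\<close>

lemma periodic_bounded_imp_function_of_nome:
  fixes f :: "complex \<Rightarrow> complex" and w :: real
  assumes hol: "f holomorphic_on upper_half_plane" and w: "w > 0"
    and per: "\<And>\<tau>. \<tau> \<in> upper_half_plane \<Longrightarrow> f (\<tau> + of_real w) = f \<tau>"
    and bdd: "f \<in> O[at_ioo](\<lambda>_. 1)"
  obtains \<Phi> where "\<Phi> holomorphic_on ball 0 1"
    "\<And>\<tau>. \<tau> \<in> upper_half_plane \<Longrightarrow> f \<tau> = \<Phi> (nome (\<tau> / of_real w))"
proof -
  \<comment> \<open>Multiplication by \<open>s\<close> inverts \<tau> \<mapsto> 2 pi i \<tau> /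
    w.\<close>
  define s where "s = of_real w / (2 * of_real pi * \<i>)"
  define \<Phi>0 where "\<Phi>0 = (\<lambda>q. f (s * Ln q))"
  have Im_s: "Im (s * z) = - (w * Re z / (2 * pi))" for z
    by (simp add: s_def Im_divide power2_eq_square field_simps)
  have in_H: "s * z \<in> upper_half_plane" if "norm (exp z) < 1" for z
    using that w unfolding upper_half_plane_def mem_Collect_eq Im_s by (simp add: divide_less_0_iff mult_less_0_iff)
  have key: "f (s * z) = f (s * z')" if "exp z = exp z'" "norm (exp z) < 1" for z z'
  proof -
    obtain k :: int where k: "z = z' + of_int (2 * k) * of_real pi * \<i>"
      using \<open>exp z = exp z'\<close> unfolding exp_eq by (auto simp: mult_ac)
    have "s * z = s * z' + of_int k * of_real w"
      by (simp add: k s_def field_simps)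
    then show ?thesis
      using periodic_int[of f w "s * z'" k, OF per in_H] that by simp
  qed
  \<comment> \<open>Two slit discs cover the punctured disc: \<open>A\<close> is cut along the
    negative real axis, \<open>B\<close> along the positive one. On \<open>B\<close> the branch
    \<open>Ln (- q) + of_real pi * \<i>\<close> replaces \<open>Ln q\<close>; by \<open>key\<close>
    the value of \<open>f\<close> is the same.\<close>
  define A :: "complex set" where "A = ball 0 1 - \<real>\<^sub>\<le>\<^sub>0"
  define B where "B = uminus -` A"
  have AB: "ball 0 1 - {0} = A \<union> B"
    by (auto simp: A_def B_def complex_nonpos_Reals_iff complex_eq_iff dist_norm)
  have "open A" by (simp add: A_def open_Diff)
  then have "open B" unfolding B_def by (intro open_vimage continuous_intros)
  have Ln_in: "s * Ln q \<in> upper_half_plane" if "q \<noteq> 0" "norm q < 1" for q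
    using that by (intro in_H) simp
  have "(f \<circ> (\<lambda>q. s * Ln q)) holomorphic_on A"
    by (rule holomorphic_on_compose_gen[OF _ hol])
       (auto intro!: holomorphic_intros Ln_in simp: A_def dist_norm)
  then have holA: "\<Phi>0 holomorphic_on A"
    by (simp add: \<Phi>0_def o_def)
  have eqB: "\<Phi>0 q = (f \<circ> (\<lambda>q. s * (Ln (- q) + of_real pi * \<i>))) q" if "q \<in> B" for q
  proof -
    have "q \<noteq> 0" "norm q < 1" using that by (auto simp: B_def A_def dist_norm)
    then show ?thesis unfolding \<Phi>0_def o_def
      by (intro key) (auto simp: exp_add)
  qed
  have "(f \<circ> (\<lambda>q. s * (Ln (- q) + of_real pi * \<i>))) holomorphic_on B"
  proof (rule holomorphic_on_compose_gen[OF _ hol])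
    show "(\<lambda>q. s * (Ln (- q) + of_real pi * \<i>)) holomorphic_on B"
      by (intro holomorphic_intros) (auto simp: A_def B_def)
    show "(\<lambda>q. s * (Ln (- q) + of_real pi * \<i>)) ` B \<subseteq> upper_half_plane"
    proof clarify
      fix q assume "q \<in> B"
      then have "q \<noteq> 0" "norm q < 1" by (auto simp: A_def B_def dist_norm)
      then show "s * (Ln (- q) + of_real pi * \<i>) \<in> upper_half_plane"
        by (intro in_H) (simp add: exp_add)
    qed
  qed
  then have holB: "\<Phi>0 holomorphic_on B"
    by (rule holomorphic_transform) (simp add: eqB)
  have hol0: "\<Phi>0 holomorphic_on (ball 0 1 - {0})"
    unfolding AB using holA holB \<open>open A\<close> \<open>open B\<close> by (rule holomorphic_on_Un)
  obtain c M where M: "\<And>\<tau>. Im \<tau> > c \<Longrightarrow> norm (f \<tau>) \<le> M"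
    using bdd unfolding bigo_ioo_1_iff by blast
  \<comment> \<open>This radius corresponds to the height \<open>c\<close>.\<close>
  have "norm (\<Phi>0 q) \<le> M" if "q \<noteq> 0" "norm q < exp (- (2 * pi * c / w))" for q
  proof -
    have "ln (norm q) < - (2 * pi * c / w)"
      using that ln_less_cancel_iff[of "norm q" "exp (- (2 * pi * c / w))"] by simp
    then have "Im (s * Ln q) > c"
      using w that by (subst Im_s) (simp add: field_simps)
    then show ?thesis unfolding \<Phi>0_def by (rule M)
  qed
  then have "eventually (\<lambda>q. norm (\<Phi>0 q) \<le> M) (at 0)"
    unfolding eventually_at by (intro exI[of _ "exp (- (2 * pi * c / w))"]) auto
  then obtain \<Phi> where \<Phi>: "\<Phi> holomorphic_on ball 0 1" "\<And>q. q \<in> ball 0 1 - {0} \<Longrightarrow> \<Phi> q = \<Phi>0 q"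
    using holomorphic_on_extend_bounded[OF hol0] by auto
  show thesis
  proof
    show "\<Phi> holomorphic_on ball 0 1" by fact
    fix \<tau> assume \<tau>: "\<tau> \<in> upper_half_plane"
    have \<tau>': "\<tau> / of_real w \<in> upper_half_plane"
      using \<tau> w by (simp add: upper_half_plane_def)
    let ?q = "nome (\<tau> / of_real w)"
    have "?q \<in> ball 0 1 - {0}"
      using norm_nome_less_1[OF \<tau>'] by simp
    then have "\<Phi> ?q = f (s * Ln ?q)"
      by (simp add: \<Phi> \<Phi>0_def)
    also have "\<dots> = f (s * (2 * of_real pi * \<i> * (\<tau> / of_real w)))"
      using norm_nome_less_1[OF \<tau>'] by (intro key) (auto simp: nome_def)
    also have "s * (2 * of_real pi * \<i> * (\<tau> / of_real w)) = \<tau>"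
      using w by (simp add: s_def)
    finally show "f \<tau> = \<Phi> ?q" by simp
  qed
qed

text \<open>The coefficients form a function on the integers and the sum is unordered, so that
  translation, dilation and restriction to multiples of \<open>P\<close> act by rescaling or
  reindexing the terms.\<close>

definition q_series :: "(int \<Rightarrow> complex) \<Rightarrow> (complex \<Rightarrow> complex) \<Rightarrow> bool" where
  "q_series c f \<longleftrightarrow> (\<exists>K. \<forall>k<K. c k = 0) \<and>
     (\<forall>\<tau>\<in>upper_half_plane. ((\<lambda>k. c k * nome \<tau> powi k) has_sum f \<tau>) UNIV)"

lemma nome_eq_1_iff: "nome z = 1 \<longleftrightarrow> z \<in> \<int>"
proof
  assume "nome z = 1"
  then obtain n :: int where "2 * of_real pi * \<i> * z = of_int (2 * n) * of_real pi * \<i>"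
    unfolding nome_def exp_eq_1 by (auto simp: complex_eq_iff)
  then have "z = of_int n" by simp
  then show "z \<in> \<int>" by simp
qed (auto elim: Ints_cases)

lemma holomorphic_nome [holomorphic_intros]:
  "h holomorphic_on A \<Longrightarrow> (\<lambda>\<tau>. nome (h \<tau>)) holomorphic_on A"
  unfolding nome_def by (intro holomorphic_intros)

lemma filterlim_nome: "filterlim nome (at 0) at_ioo"
  unfolding filterlim_at
proof
  have "((\<lambda>\<tau>. exp (- (2 * pi * Im \<tau>))) \<longlongrightarrow> 0) at_ioo"
    by (intro filterlim_compose[OF exp_at_bot] filterlim_compose[OF filterlim_uminus_at_bot_at_top]
          filterlim_tendsto_pos_mult_at_top[OF tendsto_const] filterlim_filtercomap) auto
  then show "(nome \<longlongrightarrow> 0) at_ioo"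
    by (intro Lim_null_comparison[of nome, OF always_eventually]) (auto simp: norm_nome)
qed auto

text \<open>The factor \<open>nome \<tau> powi K\<close> clears the pole; the expansion is then a
  Taylor series at 0, shifted back by \<open>K\<close>. It is provided both as a germ at 0 and as a
  sum that converges on the whole half-plane.\<close>

lemma q_expansion_of_periodic:
  assumes hol: "f holomorphic_on upper_half_plane"
    and per: "\<And>\<tau>. \<tau> \<in> upper_half_plane \<Longrightarrow> f (\<tau> + 1) = f \<tau>"
    and bdd: "(\<lambda>\<tau>. f \<tau> * nome \<tau> powi K) \<in> O[at_ioo](\<lambda>_. 1)"
  obtains L where "has_q_expansion f L" "\<And>k. k < - K \<Longrightarrow> fls_nth L k = 0" "q_series (fls_nth L) f"
proof -
  have hol': "(\<lambda>\<tau>. f \<tau> * nome \<tau> powi K) holomorphic_on upper_half_plane"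
    by (intro holomorphic_intros hol) auto
  have "f (\<tau> + of_real 1) * nome (\<tau> + of_real 1) powi K = f \<tau> * nome \<tau> powi K"
    if "\<tau> \<in> upper_half_plane" for \<tau>
    using per[OF that] nome_of_int[of 1] by (simp add: nome_add)
  from periodic_bounded_imp_function_of_nome[OF hol' zero_less_one this bdd]
  obtain \<Phi> where \<Phi>: "\<Phi> holomorphic_on ball 0 1"
    "\<And>\<tau>. \<tau> \<in> upper_half_plane \<Longrightarrow> f \<tau> * nome \<tau> powi K = \<Phi> (nome \<tau>)"
    by auto
  define \<phi> where "\<phi> = fps_expansion \<Phi> 0"
  define L where "L = fls_shift K (fps_to_fls \<phi>)"
  have f_eq: "f \<tau> = \<Phi> (nome \<tau>) * nome \<tau> powi (- K)" if "\<tau> \<in> upper_half_plane" for \<tau>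
    using \<Phi>(2)[OF that] by (simp add: power_int_minus field_simps)
  have "\<Phi> has_fps_expansion \<phi>"
    unfolding \<phi>_def using \<Phi>(1) by (intro has_fps_expansion_fps_expansion[of "ball 0 1"]) auto
  then have "(\<lambda>q. q powi (- K) * \<Phi> q) has_laurent_expansion (fls_X_intpow (- K) * fps_to_fls \<phi>)"
    by (intro laurent_expansion_intros has_laurent_expansion_fps)
  then have "(\<lambda>q. q powi (- K) * \<Phi> q) has_laurent_expansion L"
    using fls_X_intpow_times_conv_shift(1)[of "- K" "fps_to_fls \<phi>"] by (simp add: L_def)
  then have 1: "has_q_expansion f L"
    unfolding has_q_expansion_def by (intro exI conjI ballI) (simp_all add: f_eq nome_def mult.commute[of "_ powi _"])
  have 2: "fls_nth L k = 0" if "k < - K" for k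
    using that by (simp add: L_def)
  have "((\<lambda>k. fls_nth L k * nome \<tau> powi k) has_sum f \<tau>) UNIV" if \<tau>: "\<tau> \<in> upper_half_plane" for \<tau>
  proof -
    let ?q = "nome \<tau>"
    have sums: "(\<lambda>n. fps_nth \<phi> n * q ^ n) sums \<Phi> q" if "norm q < 1" for q
      using holomorphic_power_series[OF \<Phi>(1), of q] that by (simp add: \<phi>_def fps_expansion_def)
    have "summable (\<lambda>n. norm (fps_nth \<phi> n * ?q ^ n))"
    proof (rule powser_insidea)
      \<comment> \<open>Convergence at a point between \<open>?q\<close> and the unit circle in
        modulus gives absolute convergence at \<open>?q\<close>.\<close>
      let ?x = "complex_of_real ((1 + norm ?q) / 2)"
      have x: "norm ?x = (1 + norm ?q) / 2" by (simp only: norm_of_real) simp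
      then show "summable (\<lambda>n. fps_nth \<phi> n * ?x ^ n)"
        using norm_nome_less_1[OF \<tau>] by (intro sums_summable[OF sums]) simp
      show "norm ?q < norm ?x"
        using x norm_nome_less_1[OF \<tau>] by simp
    qed
    from norm_summable_imp_has_sum[OF this sums[OF norm_nome_less_1[OF \<tau>]]]
    have "((\<lambda>n. ?q powi (- K) * (fps_nth \<phi> n * ?q ^ n)) has_sum (?q powi (- K) * \<Phi> ?q)) UNIV"
      by (rule has_sum_cmult_right)
    also have "?q powi (- K) * \<Phi> ?q = f \<tau>"
      by (simp add: f_eq[OF \<tau>])
    also have "(\<lambda>n. ?q powi (- K) * (fps_nth \<phi> n * ?q ^ n)) = (\<lambda>k. fls_nth L k * ?q powi k) \<circ> (\<lambda>n. int n - K)"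
      by (auto simp: L_def fun_eq_iff power_int_diff power_int_minus field_simps)
    finally have "((\<lambda>k. fls_nth L k * ?q powi k) has_sum f \<tau>) (range (\<lambda>n. int n - K))"
      by (subst has_sum_reindex) (auto simp: inj_on_def o_def)
    then show ?thesis
    proof (subst has_sum_cong_neutral[of "range (\<lambda>n. int n - K)" UNIV _ "\<lambda>k. fls_nth L k * ?q powi k"])
      fix k assume "k \<in> UNIV - range (\<lambda>n. int n - K)"
      moreover have "k = int (nat (k + K)) - K" if "k \<ge> - K" using that by simp
      ultimately have "k < - K" using range_eqI[of k "\<lambda>n. int n - K" "nat (k + K)"] by auto
      then show "fls_nth L k * ?q powi k = 0" by (simp add: 2)
    qed auto
  qed
  then have "q_series (fls_nth L) f"
    unfolding q_series_def using 2 by blast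
  with 1 2 that show thesis by blast
qed

text \<open>The nome takes every nonzero value in the unit disc, so the two Laurent germs agree near
  0.\<close>

lemma has_q_expansion_unique:
  assumes "has_q_expansion f L" "has_q_expansion f L'"
  shows "L = L'"
proof -
  obtain F F' where F: "F has_laurent_expansion L" "\<And>\<tau>. \<tau> \<in> upper_half_plane \<Longrightarrow> f \<tau> = F (nome \<tau>)"
    and F': "F' has_laurent_expansion L'" "\<And>\<tau>. \<tau> \<in> upper_half_plane \<Longrightarrow> f \<tau> = F' (nome \<tau>)"
    using assms unfolding has_q_expansion_def nome_def by blast
  have "F q = F' q" if "q \<noteq> 0" "norm q < 1" for q
    using exists_nome[OF that] F(2) F'(2) by metis
  then have "eventually (\<lambda>q. F q = F' q) (at 0)"
    unfolding eventually_at by (intro exI[of _ 1]) auto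
  then have "F' has_laurent_expansion L"
    using F(1) by (subst (asm) has_laurent_expansion_cong) auto
  then show ?thesis
    using F'(1) has_laurent_expansion_unique by blast
qed

lemma has_q_expansion_periodic:
  assumes "has_q_expansion f L" "\<tau> \<in> upper_half_plane"
  shows "f (\<tau> + 1) = f \<tau>"
proof -
  have "\<tau> + 1 \<in> upper_half_plane"
    using assms by (simp add: upper_half_plane_def)
  moreover have "nome (\<tau> + 1) = nome \<tau>"
    using nome_of_int[of 1] by (simp add: nome_add)
  ultimately show ?thesis
    using assms unfolding has_q_expansion_def nome_def by metis
qed

text \<open>The leading term of the Laurent series gives the growth rate, with \<open>K\<close> the
  negative of the subdegree.\<close>

lemma has_q_expansion_growth:
  assumes "has_q_expansion f L"
  obtains K where "(\<lambda>\<tau>. f \<tau> * nome \<tau> powi K) \<in> O[at_ioo](\<lambda>_. 1)"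
proof -
  define n where "n = fls_subdegree L"
  obtain F where F: "F has_laurent_expansion L" "\<And>\<tau>. \<tau> \<in> upper_half_plane \<Longrightarrow> f \<tau> = F (nome \<tau>)"
    using assms unfolding has_q_expansion_def nome_def by blast
  have "F \<in> O[at 0](\<lambda>q. fls_nth L n * q powi n)"
    using has_laurent_expansion_imp_asymp_equiv_0[OF F(1)] unfolding n_def by (rule asymp_equiv_imp_bigo)
  then have "(\<lambda>\<tau>. F (nome \<tau>)) \<in> O[at_ioo](\<lambda>\<tau>. fls_nth L n * nome \<tau> powi n)"
    by (rule landau_o.big.compose[OF _ filterlim_nome])
  then have "(\<lambda>\<tau>. F (nome \<tau>) * nome \<tau> powi (- n)) \<in> O[at_ioo](\<lambda>\<tau>. fls_nth L n * nome \<tau> powi n * nome \<tau> powi (- n))"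
    by (intro landau_o.big.mult) auto
  also have "(\<lambda>\<tau>. fls_nth L n * nome \<tau> powi n * nome \<tau> powi (- n)) = (\<lambda>_. fls_nth L n)"
    by (simp add: power_int_minus mult.assoc)
  also have "(\<lambda>_. fls_nth L n) \<in> O[at_ioo](\<lambda>_. 1 :: complex)" by simp
  finally have "(\<lambda>\<tau>. F (nome \<tau>) * nome \<tau> powi (- n)) \<in> O[at_ioo](\<lambda>_. 1)" .
  moreover have "eventually (\<lambda>\<tau>. F (nome \<tau>) * nome \<tau> powi (- n) = f \<tau> * nome \<tau> powi (- n)) at_ioo"
    using eventually_upper_half_plane by eventually_elim (simp add: F(2))
  ultimately have "(\<lambda>\<tau>. f \<tau> * nome \<tau> powi (- n)) \<in> O[at_ioo](\<lambda>_. 1)"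
    by (subst (asm) landau_o.big.in_cong)
  then show thesis by (rule that)
qed

section \<open>Operations on q-series and uniqueness of their coefficients\<close>

lemma q_series_cong:
  assumes "q_series c f" "\<And>k. c k = d k" "\<And>\<tau>. \<tau> \<in> upper_half_plane \<Longrightarrow> f \<tau> = h \<tau>"
  shows "q_series d h"
proof -
  have "c = d" using assms(2) by (rule ext)
  then show ?thesis using assms unfolding q_series_def by simp
qed

lemma q_series_add:
  assumes "q_series c f" "q_series d h"
  shows "q_series (\<lambda>k. c k + d k) (\<lambda>\<tau>. f \<tau> + h \<tau>)"
proof -
  obtain K K' where "\<forall>k<K. c k = 0" "\<forall>k<K'. d k = 0"
    using assms unfolding q_series_def by blast
  then have "\<forall>k<min K K'. c k + d k = 0" by simp
  then have "\<exists>K. \<forall>k<K. c k + d k = 0" by blast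
  then show ?thesis
    using assms unfolding q_series_def by (simp add: distrib_right has_sum_add)
qed

lemma q_series_cmult:
  assumes "q_series c f"
  shows "q_series (\<lambda>k. a * c k) (\<lambda>\<tau>. a * f \<tau>)"
  using assms unfolding q_series_def by (auto simp: mult.assoc intro!: has_sum_cmult_right)

lemma q_series_diff:
  assumes "q_series c f" "q_series d h"
  shows "q_series (\<lambda>k. c k - d k) (\<lambda>\<tau>. f \<tau> - h \<tau>)"
  using q_series_add[OF assms(1) q_series_cmult[OF assms(2), of "-1"]] by simp

lemma q_series_0: "q_series (\<lambda>_. 0) (\<lambda>_. 0)"
  by (simp add: q_series_def)

lemma q_series_sum:
  assumes "finite I" "\<And>i. i \<in> I \<Longrightarrow> q_series (c i) (f i)"
  shows "q_series (\<lambda>k. \<Sum>i\<in>I. c i k) (\<lambda>\<tau>. \<Sum>i\<in>I. f i \<tau>)"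
  using assms by (induction rule: finite_induct) (auto intro: q_series_0 q_series_add)

lemma q_series_const: "q_series (\<lambda>k. if k = 0 then a else 0) (\<lambda>_. a)"
  unfolding q_series_def
proof (intro conjI ballI)
  show "\<exists>K. \<forall>k<K. (if k = (0::int) then a else 0) = 0" by (intro exI[of _ 0]) auto
  fix \<tau> :: complex
  show "((\<lambda>k. (if k = 0 then a else 0) * nome \<tau> powi k) has_sum a) UNIV"
    by (rule has_sum_finite_neutralI[of "{0}"]) auto
qed

lemma q_series_translate:
  assumes "q_series c f"
  shows "q_series (\<lambda>k. c k * nome (of_int k * of_real x)) (\<lambda>\<tau>. f (\<tau> + of_real x))"
  unfolding q_series_def
proof (intro conjI ballI)
  show "\<exists>K. \<forall>k<K. c k * nome (of_int k * of_real x) = 0"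
    using assms unfolding q_series_def by auto
  fix \<tau> assume "\<tau> \<in> upper_half_plane"
  then have "\<tau> + of_real x \<in> upper_half_plane" by (simp add: upper_half_plane_def)
  then have "((\<lambda>k. c k * nome (\<tau> + of_real x) powi k) has_sum f (\<tau> + of_real x)) UNIV"
    using assms unfolding q_series_def by blast
  then show "((\<lambda>k. c k * nome (of_int k * of_real x) * nome \<tau> powi k) has_sum f (\<tau> + of_real x)) UNIV"
    by (simp add: nome_add power_int_mult_distrib nome_mult_int mult_ac)
qed

lemma q_series_dilate:
  assumes "q_series c f" "P > 0"
  shows "q_series (\<lambda>k. if int P dvd k then c (k div int P) else 0) (\<lambda>\<tau>. f (of_nat P * \<tau>))"
  unfolding q_series_def
proof (intro conjI ballI)
  obtain K where K: "\<forall>k<K. c k = 0"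
    using assms unfolding q_series_def by blast
  have "(if int P dvd k then c (k div int P) else 0) = 0" if "k < int P * K" for k
  proof (cases "int P dvd k")
    case True
    then have "k div int P < K" using that assms(2) by (auto elim!: dvdE)
    then show ?thesis using K by simp
  qed simp
  then show "\<exists>K. \<forall>k<K. (if int P dvd k then c (k div int P) else 0) = 0" by blast
  fix \<tau> assume "\<tau> \<in> upper_half_plane"
  then have "of_nat P * \<tau> \<in> upper_half_plane" using assms(2) by (simp add: upper_half_plane_def)
  then have *: "((\<lambda>k. c k * nome (of_nat P * \<tau>) powi k) has_sum f (of_nat P * \<tau>)) UNIV"
    using assms unfolding q_series_def by blast
  have eq: "(\<lambda>k. c k * nome (of_nat P * \<tau>) powi k) =
    (\<lambda>k. (if int P dvd k then c (k div int P) else 0) * nome \<tau> powi k) \<circ> (\<lambda>k. int P * k)"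
    using assms(2) by (auto simp: fun_eq_iff nome_mult_nat power_int_mult)
  have "((\<lambda>k. (if int P dvd k then c (k div int P) else 0) * nome \<tau> powi k) has_sum f (of_nat P * \<tau>))
    (range (\<lambda>k. int P * k))"
    using * assms(2) unfolding eq by (subst has_sum_reindex) (auto simp: inj_on_def)
  then show "((\<lambda>k. (if int P dvd k then c (k div int P) else 0) * nome \<tau> powi k) has_sum f (of_nat P * \<tau>)) UNIV"
    by (rule has_sum_cong_neutral[THEN iffD1, rotated -1]) (auto elim!: dvdE)
qed

lemma sum_nome_roots_of_unity:
  assumes "P > 0"
  shows "(\<Sum>b<P. nome (of_int k * of_real (real b / real P))) = (if int P dvd k then of_nat P else 0)"
proof -
  define x where "x = nome (of_int k / of_nat P)"
  have terms: "nome (of_int k * of_real (real b / real P)) = x ^ b" for b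
    by (simp add: x_def field_simps flip: nome_mult_nat)
  have "x ^ P = nome (of_int k)"
    using assms by (simp add: x_def del: nome_of_int flip: nome_mult_nat)
  then have xP: "x ^ P = 1" by simp
  have x1: "x = 1 \<longleftrightarrow> int P dvd k"
  proof
    assume "x = 1"
    then obtain n where "of_int k / of_nat P = (of_int n :: complex)"
      unfolding x_def nome_eq_1_iff by (auto elim: Ints_cases)
    then have "(of_int k :: complex) = of_int (n * int P)"
      using assms by (simp add: field_simps)
    then have "k = n * int P" by (simp only: of_int_eq_iff)
    then show "int P dvd k" by simp
  next
    assume "int P dvd k"
    then obtain n where "k = int P * n" by (auto elim: dvdE)
    then show "x = 1" using assms by (simp add: x_def)
  qed
  have "(\<Sum>b<P. nome (of_int k * of_real (real b / real P))) = (\<Sum>b<P. x ^ b)"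
    by (intro sum.cong refl terms)
  also have "\<dots> = (if int P dvd k then of_nat P else 0)"
    using xP by (simp add: x1[symmetric] sum_gp_strict)
  finally show ?thesis .
qed

text \<open>Summing the roots of unity that come from the translations by b / P keeps exactly the
  exponents divisible by \<open>P\<close>.\<close>

lemma q_series_trace:
  assumes c: "q_series c f" and P: "P > 0"
  shows "q_series (\<lambda>k. if int P dvd k then of_nat P * c k else 0) (\<lambda>\<tau>. \<Sum>b<P. f (\<tau> + of_real (real b / real P)))"
proof -
  have "q_series (\<lambda>k. \<Sum>b<P. c k * nome (of_int k * of_real (real b / real P)))
     (\<lambda>\<tau>. \<Sum>b<P. f (\<tau> + of_real (real b / real P)))"
    by (intro q_series_sum q_series_translate c) auto
  then show ?thesis
    by (rule q_series_cong) (unfold sum_distrib_left[symmetric] sum_nome_roots_of_unity[OF P], auto)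
qed

text \<open>This is \<open>P\<close> times the operator U_P: evaluating the trace at \<tau> / P
  divides the surviving exponents by \<open>P\<close>.\<close>

lemma q_series_U:
  assumes c: "q_series c f" and P: "P > 0"
  shows "q_series (\<lambda>k. of_nat P * c (int P * k)) (\<lambda>\<tau>. \<Sum>b<P. f ((\<tau> + of_nat b) / of_nat P))"
  unfolding q_series_def
proof (intro conjI ballI)
  obtain K where K: "\<forall>k<K. c k = 0"
    using assms unfolding q_series_def by blast
  \<comment> \<open>The minimum with 0 is needed because P k \<le> k holds for negative
    \<open>k\<close> only, while \<open>K\<close> may be positive.\<close>
  have "of_nat P * c (int P * k) = 0" if "k < min K 0" for k
  proof -
    have "int P * k \<le> 1 * k" using that P by (intro mult_right_mono_neg) auto
    then have "int P * k < K" using that by linarith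
    then show ?thesis using K by simp
  qed
  then show "\<exists>K. \<forall>k<K. of_nat P * c (int P * k) = 0" by blast
  fix \<tau> assume \<tau>: "\<tau> \<in> upper_half_plane"
  let ?d = "\<lambda>k. if int P dvd k then of_nat P * c k else 0"
  have "\<tau> / of_nat P \<in> upper_half_plane"
    using \<tau> P by (simp add: upper_half_plane_def)
  then have "((\<lambda>k. ?d k * nome (\<tau> / of_nat P) powi k) has_sum
      (\<Sum>b<P. f (\<tau> / of_nat P + of_real (real b / real P)))) UNIV"
    using q_series_trace[OF assms] unfolding q_series_def by blast
  then have "((\<lambda>k. ?d k * nome (\<tau> / of_nat P) powi k) has_sum
      (\<Sum>b<P. f ((\<tau> + of_nat b) / of_nat P))) UNIV"
    by (simp add: add_divide_distrib)
  then have "((\<lambda>k. ?d k * nome (\<tau> / of_nat P) powi k) has_sum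
      (\<Sum>b<P. f ((\<tau> + of_nat b) / of_nat P))) (range (\<lambda>k. int P * k))"
    by (rule has_sum_cong_neutral[THEN iffD1, rotated -1]) (auto elim!: dvdE)
  then have "((\<lambda>k. ?d k * nome (\<tau> / of_nat P) powi k) \<circ> (\<lambda>k. int P * k) has_sum
      (\<Sum>b<P. f ((\<tau> + of_nat b) / of_nat P))) UNIV"
    using P by (subst (asm) has_sum_reindex) (auto simp: inj_on_def)
  moreover have "nome (\<tau> / of_nat P) powi (int P * k) = nome \<tau> powi k" for k
    using P by (simp add: power_int_mult flip: nome_mult_nat)
  ultimately show "((\<lambda>k. of_nat P * c (int P * k) * nome \<tau> powi k) has_sum
      (\<Sum>b<P. f ((\<tau> + of_nat b) / of_nat P))) UNIV"
    by (simp add: o_def)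
qed

text \<open>For Im \<tau> > 1 the terms with nonnegative exponents are dominated by those at \<tau>
  = i, where the series converges absolutely.\<close>

lemma q_series_bounded:
  assumes c: "q_series c f" and nonneg: "\<And>k. k < 0 \<Longrightarrow> c k = 0"
  shows "f \<in> O[at_ioo](\<lambda>_. 1)"
proof -
  have "\<i> \<in> upper_half_plane" by (simp add: upper_half_plane_def)
  then have "(\<lambda>k. c k * nome \<i> powi k) summable_on UNIV"
    using c has_sum_imp_summable unfolding q_series_def by blast
  then have abs_i: "(\<lambda>k. norm (c k * nome \<i> powi k)) summable_on UNIV"
    by (rule summable_on_iff_abs_summable_on_complex[THEN iffD1])
  have "norm (f \<tau>) \<le> (\<Sum>\<^sub>\<infinity>k. norm (c k * nome \<i> powi k))" if "Im \<tau> > 1" for \<tau>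
  proof -
    have \<tau>: "\<tau> \<in> upper_half_plane" using that by (simp add: upper_half_plane_def)
    then have s: "((\<lambda>k. c k * nome \<tau> powi k) has_sum f \<tau>) UNIV"
      using c unfolding q_series_def by blast
    then have abs_\<tau>: "(\<lambda>k. norm (c k * nome \<tau> powi k)) summable_on UNIV"
      by (intro summable_on_iff_abs_summable_on_complex[THEN iffD1] has_sum_imp_summable)
    have "norm (c k * nome \<tau> powi k) \<le> norm (c k * nome \<i> powi k)" for k
    proof (cases "k < 0")
      case False
      have "norm (nome \<tau>) \<le> norm (nome \<i>)" using that by (simp add: norm_nome)
      then have "norm (nome \<tau>) powi k \<le> norm (nome \<i>) powi k"
        using False by (intro power_int_mono) auto
      then show ?thesis by (simp add: norm_mult norm_power_int mult_left_mono)
    qed (simp add: nonneg)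
    then have "(\<Sum>\<^sub>\<infinity>k. norm (c k * nome \<tau> powi k)) \<le> (\<Sum>\<^sub>\<infinity>k. norm (c k * nome \<i> powi k))"
      by (intro infsum_mono abs_i abs_\<tau>)
    moreover have "norm (f \<tau>) \<le> (\<Sum>\<^sub>\<infinity>k. norm (c k * nome \<tau> powi k))"
      using norm_has_sum_bound[OF has_sum_infsum[OF abs_\<tau>] s] .
    ultimately show ?thesis by simp
  qed
  then show ?thesis unfolding bigo_ioo_1_iff by blast
qed

text \<open>After a shift by \<open>K\<close> this is a power series that vanishes on the punctured
  disc; a nonzero coefficient would contradict the isolation of zeros.\<close>

lemma q_series_eq_0:
  assumes c: "q_series c f" and f: "\<And>\<tau>. \<tau> \<in> upper_half_plane \<Longrightarrow> f \<tau> = 0"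
  shows "c k = 0"
proof -
  obtain K where K: "\<forall>k<K. c k = 0"
    using c unfolding q_series_def by blast
  define a where "a n = c (int n + K)" for n
  have a_sums: "(\<lambda>n. a n * q ^ n) sums 0" if q: "q \<noteq> 0" "norm q < 1" for q
  proof -
    obtain \<tau> where \<tau>: "\<tau> \<in> upper_half_plane" "nome \<tau> = q"
      using exists_nome[OF q] .
    then have "((\<lambda>k. c k * q powi k) has_sum 0) UNIV"
      using c f unfolding q_series_def by fastforce
    then have "((\<lambda>k. c k * q powi k) has_sum 0) (range (\<lambda>n. int n + K))"
    proof (rule has_sum_cong_neutral[THEN iffD1, rotated -1])
      fix k assume "k \<in> UNIV - range (\<lambda>n. int n + K)"
      moreover have "k = int (nat (k - K)) + K" if "k \<ge> K" using that by simp
      ultimately have "k < K" using range_eqI[of k "\<lambda>n. int n + K" "nat (k - K)"] by auto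
      then show "c k * q powi k = 0" using K by simp
    qed auto
    then have "((\<lambda>k. c k * q powi k) \<circ> (\<lambda>n. int n + K) has_sum 0) UNIV"
      by (subst (asm) has_sum_reindex) (auto simp: inj_on_def)
    then have "((\<lambda>n. q powi (- K) * (((\<lambda>k. c k * q powi k) \<circ> (\<lambda>n. int n + K)) n)) has_sum (q powi (- K) * 0)) UNIV"
      by (rule has_sum_cmult_right)
    also have "(\<lambda>n. q powi (- K) * (((\<lambda>k. c k * q powi k) \<circ> (\<lambda>n. int n + K)) n)) = (\<lambda>n. a n * q ^ n)"
      using that by (simp add: fun_eq_iff a_def power_int_add power_int_minus field_simps)
    finally show ?thesis using has_sum_imp_sums by simp
  qed
  have "a n = 0" for n
  proof (rule ccontr)
    assume n: "a n \<noteq> 0"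
    have sm: "(\<lambda>n. a n * (q - 0) ^ n) sums (if q = 0 then a 0 else 0)" if "norm (q - 0) < 1" for q
      using a_sums[of q] powser_sums_zero[of a] that by (cases "q = 0") auto
    have sm': "(\<lambda>n. a n * (q - 0) ^ n * q) sums ((if q = 0 then a 0 else 0) * q)" if "norm (q - 0) < 1" for q
      using sums_mult2[OF sm[OF that]] .
    show False
    proof -
      \<comment> \<open>At q = 0 the sum is only known to be \<open>a 0\<close>. Multiplying the
        series by \<open>q\<close> makes it vanish there too and moves the nonzero coefficient to
        the positive index \<open>Suc n\<close>.\<close>
      define b where "b n = (case n of 0 \<Rightarrow> 0 | Suc m \<Rightarrow> a m)" for n
      have b_sums: "(\<lambda>n. b n * (q - 0) ^ n) sums 0" if "norm (q - 0) < 1" for q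
      proof -
        have "(\<lambda>n. b (Suc n) * (q - 0) ^ Suc n) sums 0"
          using sm'[OF that] by (cases "q = 0") (auto simp: b_def mult_ac)
        then show ?thesis using sums_Suc_iff[of "\<lambda>n. b n * (q - 0) ^ n"] by (simp add: b_def)
      qed
      obtain s where s: "0 < s" "\<And>z. z \<in> cball 0 s - {0} \<Longrightarrow> (\<lambda>_::complex. 0::complex) z \<noteq> 0"
        using powser_0_nonzero[of 1 0 b "\<lambda>_. 0" "Suc n"] b_sums n by (auto simp: b_def)
      then have "complex_of_real s \<in> cball 0 s - {0}" by simp
      then show False using s(2) by blast
    qed
  qed
  then show ?thesis
    using K a_def[of "nat (k - K)"] by (cases "k < K") auto
qed

lemma q_series_unique:
  assumes "q_series c f" "q_series d f"
  shows "c = d"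
  using q_series_eq_0[OF q_series_diff[OF assms]] by (auto simp: fun_eq_iff)

section \<open>Matrices and the Eichler order\<close>

abbreviation m11 :: "real ^ 2 ^ 2 \<Rightarrow> real" where "m11 A \<equiv> A $ 1 $ 1"
abbreviation m12 :: "real ^ 2 ^ 2 \<Rightarrow> real" where "m12 A \<equiv> A $ 1 $ 2"
abbreviation m21 :: "real ^ 2 ^ 2 \<Rightarrow> real" where "m21 A \<equiv> A $ 2 $ 1"
abbreviation m22 :: "real ^ 2 ^ 2 \<Rightarrow> real" where "m22 A \<equiv> A $ 2 $ 2"

lemma mat2_nth [simp]:
  "m11 (mat2 a b c d) = a" "m12 (mat2 a b c d) = b"
  "m21 (mat2 a b c d) = c" "m22 (mat2 a b c d) = d"
  by (simp_all add: mat2_def)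

lemma mat2_eq_iff:
  fixes A B :: "real ^ 2 ^ 2"
  shows "(A = B) = (m11 A = m11 B \<and> m12 A = m12 B \<and>
    m21 A = m21 B \<and> m22 A = m22 B)"
  unfolding vec_eq_iff forall_2 by blast

lemma mat2_mult_nth:
  fixes A B :: "real ^ 2 ^ 2"
  shows "m11 (A ** B) = m11 A * m11 B + m12 A * m21 B" "m12 (A ** B) = m11 A * m12 B + m12 A * m22 B"
    "m21 (A ** B) = m21 A * m11 B + m22 A * m21 B" "m22 (A ** B) = m21 A * m12 B + m22 A * m22 B"
  by (simp_all add: matrix_matrix_mult_def sum_2)

lemma mat2_mult [simp]:
  "mat2 a b c d ** mat2 a' b' c' d' =
   mat2 (a * a' + b * c') (a * b' + b * d') (c * a' + d * c') (c * b' + d * d')"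
  by (simp add: mat2_eq_iff mat2_mult_nth)

lemma det_mat2 [simp]: "det (mat2 a b c d) = a * d - b * c"
  by (simp add: det_2)

lemma mat_1_eq_mat2: "mat 1 = mat2 1 0 0 1"
  by (simp add: mat2_eq_iff mat_def)

text \<open>The adjugate, which is the inverse at determinant 1. As it only permutes entries and
  changes signs, it preserves the Eichler order for every determinant.\<close>

definition adj2 :: "real ^ 2 ^ 2 \<Rightarrow> real ^ 2 ^ 2" where
  "adj2 A = mat2 (m22 A) (- (m12 A)) (- (m21 A)) (m11 A)"

lemma adj2_mat2 [simp]: "adj2 (mat2 a b c d) = mat2 d (- b) (- c) a"
  by (simp add: adj2_def)

lemma adj2_adj2 [simp]: "adj2 (adj2 A) = A"
  by (simp add: adj2_def mat2_eq_iff)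

lemma det_adj2 [simp]: "det (adj2 A) = det A"
  by (simp add: adj2_def det_2)

lemma adj2_mult: "adj2 (A ** B) = adj2 B ** adj2 A"
  by (simp add: adj2_def mat2_eq_iff mat2_mult_nth)

lemma mult_adj2: "det A = 1 \<Longrightarrow> A ** adj2 A = mat 1" "det A = 1 \<Longrightarrow> adj2 A ** A = mat 1"
  by (simp_all add: adj2_def mat2_eq_iff mat2_mult_nth mat_1_eq_mat2 det_2 mult.commute)

lemma adj2_cancel:
  fixes A B :: "real ^ 2 ^ 2"
  assumes "det A = 1"
  shows "A ** (adj2 A ** B) = B" "adj2 A ** (A ** B) = B"
  using mult_adj2[OF assms] by (simp_all add: matrix_mul_assoc)

lemma mult_left_cancel_det:
  fixes A B C :: "real ^ 2 ^ 2"
  assumes "A ** C = B ** C" "det C \<noteq> 0"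
  shows "A = B"
proof -
  have "invertible C" using assms(2) by (simp add: invertible_det_nz)
  then obtain D where "C ** D = mat 1" unfolding invertible_def by blast
  then show ?thesis
    using assms(1) by (metis matrix_mul_assoc matrix_mul_rid)
qed

lemma mobius_denominator_nonzero:
  assumes "det A > 0" "z \<in> upper_half_plane"
  shows "of_real (m21 A) * z + of_real (m22 A) \<noteq> 0"
proof
  assume 0: "of_real (m21 A) * z + of_real (m22 A) = 0"
  then have "Im (of_real (m21 A) * z + of_real (m22 A)) = 0" by simp
  then have "m21 A = 0" using assms(2) by (simp add: upper_half_plane_def)
  with 0 show False using assms(1) by (simp add: det_2)
qed

lemma mobius_in_upper_half_plane:
  assumes "det A > 0" "z \<in> upper_half_plane"
  shows "mobius A z \<in> upper_half_plane"
proof -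
  let ?D = "of_real (m21 A) * z + of_real (m22 A)"
  let ?n = "of_real (m11 A) * z + of_real (m12 A)"
  have D: "?D \<noteq> 0" by (rule mobius_denominator_nonzero[OF assms])
  have "?n / ?D = ?n * cnj ?D / of_real ((norm ?D)\<^sup>2)"
    by (simp only: complex_div_cnj[of ?n ?D] of_real_power)
  then have "Im (?n / ?D) = Im (?n * cnj ?D) / (norm ?D)\<^sup>2"
    by (simp only: Im_divide_of_real)
  also have "Im (?n * cnj ?D) = det A * Im z"
    by (simp add: det_2 algebra_simps)
  finally show ?thesis
    using assms D by (simp add: mobius_def upper_half_plane_def)
qed

lemma mobius_mult:
  assumes "det A > 0" "det B > 0" "z \<in> upper_half_plane"
  shows "mobius (A ** B) z = mobius A (mobius B z)"
proof -
  let ?D = "of_real (m21 B) * z + of_real (m22 B)"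
  have D: "?D \<noteq> 0" using mobius_denominator_nonzero assms by blast
  have B: "mobius B z * ?D = of_real (m11 B) * z + of_real (m12 B)"
    using D by (simp add: mobius_def)
  have eq: "of_real (x * m11 B + y * m21 B) * z + of_real (x * m12 B + y * m22 B)
     = (of_real x * mobius B z + of_real y) * ?D" for x y
  proof -
    have "(of_real x * mobius B z + of_real y) * ?D = of_real x * (mobius B z * ?D) + of_real y * ?D"
      by (simp add: algebra_simps)
    then show ?thesis unfolding B by (simp add: algebra_simps)
  qed
  show ?thesis
    unfolding mobius_def[of "A ** B"] mat2_mult_nth eq mobius_def[of A]
    using D by simp
qed

lemma mobius_holomorphic:
  assumes "det A > 0"
  shows "mobius A holomorphic_on upper_half_plane"
proof -
  have "(\<lambda>z. (of_real (m11 A) * z + of_real (m12 A)) /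
      (of_real (m21 A) * z + of_real (m22 A))) holomorphic_on upper_half_plane"
    using mobius_denominator_nonzero[OF assms] by (intro holomorphic_intros) auto
  then show ?thesis by (simp add: mobius_def[abs_def])
qed

lemma mobius_mat_1 [simp]: "mobius (mat 1) z = z"
  by (simp add: mat_1_eq_mat2 mobius_def)

section \<open>The Eichler order, its units of determinant 1 and its normalizer\<close>

definition Eichler_order :: "nat \<Rightarrow> (real ^ 2 ^ 2) set" where
  "Eichler_order N = {mat2 (of_int a) (of_int b) (of_int (int N * c)) (of_int d) | a b c d :: int. True}"

lemma Eichler_orderI:
  "m11 A = of_int a \<Longrightarrow> m12 A = of_int b \<Longrightarrow> m21 A = of_int (int N * c) \<Longrightarrow>
   m22 A = of_int d \<Longrightarrow> A \<in> Eichler_order N"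
  unfolding Eichler_order_def mat2_eq_iff[of A] mem_Collect_eq
  by (intro exI[of _ a] exI[of _ b] exI[of _ c] exI[of _ d]) (simp add: mat2_eq_iff)

lemma Eichler_orderE:
  assumes "A \<in> Eichler_order N"
  obtains a b c d :: int where "A = mat2 (of_int a) (of_int b) (of_int (int N * c)) (of_int d)"
  using assms unfolding Eichler_order_def by blast

lemma Eichler_order_mult:
  assumes "A \<in> Eichler_order N" "B \<in> Eichler_order N"
  shows "A ** B \<in> Eichler_order N"
proof -
  obtain a b c d where A: "A = mat2 (of_int a) (of_int b) (of_int (int N * c)) (of_int d)"
    using assms(1) by (rule Eichler_orderE)
  obtain a' b' c' d' where B: "B = mat2 (of_int a') (of_int b') (of_int (int N * c')) (of_int d')"
    using assms(2) by (rule Eichler_orderE)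
  show ?thesis unfolding A B mat2_mult
    by (rule Eichler_orderI[of _ "a * a' + b * (int N * c')" "a * b' + b * d'" _ "c * a' + d * c'" "(int N * c) * b' + d * d'"])
       (simp_all add: algebra_simps)
qed

lemma adj2_Eichler_order:
  assumes "A \<in> Eichler_order N"
  shows "adj2 A \<in> Eichler_order N"
proof -
  obtain a b c d where A: "A = mat2 (of_int a) (of_int b) (of_int (int N * c)) (of_int d)"
    using assms(1) by (rule Eichler_orderE)
  show ?thesis unfolding A adj2_mat2
    by (rule Eichler_orderI[of _ d "- b" _ "- c" a]) simp_all
qed

lemma Eichler_order_add_scale:
  assumes "A \<in> Eichler_order N" "B \<in> Eichler_order N"
  shows "A + of_int i *\<^sub>R (B - A) \<in> Eichler_order N"
proof -
  obtain a b c d where A: "A = mat2 (of_int a) (of_int b) (of_int (int N * c)) (of_int d)"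
    using assms(1) by (rule Eichler_orderE)
  obtain a' b' c' d' where B: "B = mat2 (of_int a') (of_int b') (of_int (int N * c')) (of_int d')"
    using assms(2) by (rule Eichler_orderE)
  show ?thesis unfolding A B
    by (rule Eichler_orderI[of _ "a + i * (a' - a)" "b + i * (b' - b)" _ "c + i * (c' - c)" "d + i * (d' - d)"])
       (simp_all add: algebra_simps)
qed

lemma Gamma0_eq: "Gamma0 N = {A \<in> Eichler_order N. det A = 1}"
proof (intro equalityI subsetI)
  fix A assume "A \<in> Gamma0 N"
  then obtain a b c d :: int where A: "A = mat2 (of_int a) (of_int b) (of_int c) (of_int d)"
    "a * d - b * c = 1" "int N dvd c"
    unfolding Gamma0_def by blast
  then have "of_int (a * d - b * c) = (1 :: real)" by simp
  with A show "A \<in> {A \<in> Eichler_order N. det A = 1}"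
    by (auto elim!: dvdE intro!: Eichler_orderI)
next
  fix A assume "A \<in> {A \<in> Eichler_order N. det A = 1}"
  then obtain a b c d :: int where A: "A = mat2 (of_int a) (of_int b) (of_int (int N * c)) (of_int d)"
    and "det A = 1"
    by (auto elim: Eichler_orderE)
  then have "of_int (a * d - b * (int N * c)) = (1 :: real)" by simp
  then have "a * d - b * (int N * c) = 1" by (simp only: of_int_eq_1_iff)
  then show "A \<in> Gamma0 N" unfolding Gamma0_def mem_Collect_eq A
    by (intro exI[of _ a] exI[of _ b] exI[of _ "int N * c"] exI[of _ d]) simp
qed

lemma Gamma0_mult: "A \<in> Gamma0 N \<Longrightarrow> B \<in> Gamma0 N \<Longrightarrow> A ** B \<in> Gamma0 N"
  by (simp add: Gamma0_eq Eichler_order_mult det_mul)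

lemma Gamma0_adj2: "A \<in> Gamma0 N \<Longrightarrow> adj2 A \<in> Gamma0 N"
  by (simp add: Gamma0_eq adj2_Eichler_order)

lemma Gamma0_one: "mat 1 \<in> Gamma0 N"
  by (auto simp: Gamma0_eq mat_1_eq_mat2 intro: Eichler_orderI[of _ 1 0 _ 0 1])

lemma Gamma0_det: "A \<in> Gamma0 N \<Longrightarrow> det A = 1"
  by (simp add: Gamma0_eq)

lemma Gamma0_translation: "mat2 1 (of_int k) 0 1 \<in> Gamma0 N"
  by (auto simp: Gamma0_eq intro: Eichler_orderI[of _ 1 k _ 0 1])

text \<open>Both conjugations are required, so that the property passes to inverses at once.\<close>

definition normalizes :: "real ^ 2 ^ 2 \<Rightarrow> nat \<Rightarrow> bool" where
  "normalizes A N \<longleftrightarrow> det A = 1 \<and>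
     (\<forall>X\<in>Eichler_order N. adj2 A ** X ** A \<in> Eichler_order N \<and> A ** X ** adj2 A \<in> Eichler_order N)"

lemma normalizes_adj2: "normalizes A N \<Longrightarrow> normalizes (adj2 A) N"
  by (simp add: normalizes_def)

lemma normalizes_mult:
  assumes "normalizes A N" "normalizes B N"
  shows "normalizes (A ** B) N"
proof -
  have "adj2 (A ** B) ** X ** (A ** B) = adj2 B ** (adj2 A ** X ** A) ** B"
       "(A ** B) ** X ** adj2 (A ** B) = A ** (B ** X ** adj2 B) ** adj2 A" for X
    by (simp_all add: adj2_mult matrix_mul_assoc)
  then show ?thesis using assms by (simp add: normalizes_def det_mul)
qed

lemma normalizes_Gamma0: "A \<in> Gamma0 N \<Longrightarrow> normalizes A N"
  by (simp add: normalizes_def Gamma0_eq Eichler_order_mult adj2_Eichler_order)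

text \<open>With N = Q M, every entry of the conjugate carries the factor Q that cancels the two
  denominators sqrt Q, and the lower left entry keeps the factor N. The Atkin-Lehner set is closed
  under \<open>adj2\<close>, so one direction of conjugation gives the other.\<close>

lemma normalizes_Atkin_Lehner:
  assumes A: "A \<in> Atkin_Lehner N Q" and Q: "Q dvd N" "N \<ge> 1"
  shows "normalizes A N"
proof -
  have "Q > 0" using Q by (auto intro!: Nat.gr0I)
  obtain M where N: "N = Q * M" using Q by (auto elim: dvdE)
  have conj: "adj2 W ** X ** W \<in> Eichler_order N"
    if W: "W \<in> Atkin_Lehner N Q" and X: "X \<in> Eichler_order N" for W X
  proof -
    define s where "s = sqrt (real Q)"
    have s: "s * s = real Q" "s \<noteq> 0" using \<open>Q > 0\<close> by (simp_all add: s_def)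
    obtain x y z w :: int where W: "W = mat2 (of_int (int Q * x) / s) (of_int y / s)
        (of_int (int N * z) / s) (of_int (int Q * w) / s)"
      using W unfolding Atkin_Lehner_def s_def by blast
    obtain a b c d where X: "X = mat2 (of_int a) (of_int b) (of_int (int N * c)) (of_int d)"
      using X by (rule Eichler_orderE)
    show ?thesis unfolding W X adj2_mat2 mat2_mult
    proof (rule Eichler_orderI[of _
          "int Q * w * a * x - y * int N * c * x + int N * w * b * z - y * d * int M * z"
          "w * a * y - y * y * int M * c + int Q * w * w * b - y * d * w"
          _ "- z * a * x + int Q * x * x * c - int M * z * z * b + x * d * z"
          "- int M * z * a * y + x * int N * c * y - int N * z * b * w + int Q * x * d * w"])
    qed (use \<open>Q > 0\<close> s in \<open>simp_all add: N field_simps\<close>)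
  qed
  have adj: "adj2 A \<in> Atkin_Lehner N Q"
  proof -
    obtain x y z w :: int where W: "A = mat2 (of_int (int Q * x) / sqrt (real Q)) (of_int y / sqrt (real Q))
        (of_int (int N * z) / sqrt (real Q)) (of_int (int Q * w) / sqrt (real Q))"
      "(int Q * x) * (int Q * w) - y * (int N * z) = int Q"
      using A unfolding Atkin_Lehner_def by blast
    show ?thesis unfolding Atkin_Lehner_def mem_Collect_eq
      by (rule exI[of _ w], rule exI[of _ "- y"], rule exI[of _ "- z"], rule exI[of _ x])
         (use W in \<open>simp add: mult_ac\<close>)
  qed
  have "det A = 1"
  proof -
    obtain x y z w :: int where W: "A = mat2 (of_int (int Q * x) / sqrt (real Q)) (of_int y / sqrt (real Q))
        (of_int (int N * z) / sqrt (real Q)) (of_int (int Q * w) / sqrt (real Q))"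
      "(int Q * x) * (int Q * w) - y * (int N * z) = int Q"
      using A unfolding Atkin_Lehner_def by blast
    have "real_of_int ((int Q * x) * (int Q * w) - y * (int N * z)) = real Q"
      unfolding W(2) by simp
    then show ?thesis
      using \<open>Q > 0\<close> by (simp add: W(1) field_simps)
  qed
  then show ?thesis
    unfolding normalizes_def using conj[OF A] conj[OF adj] by simp
qed

lemma group_SL2R: "group SL2R"
proof (rule groupI)
  fix x assume "x \<in> carrier SL2R"
  then show "\<exists>y\<in>carrier SL2R. y \<otimes>\<^bsub>SL2R\<^esub> x = \<one>\<^bsub>SL2R\<^esub>"
    by (intro bexI[of _ "adj2 x"]) (auto simp: SL2R_def mult_adj2)
qed (auto simp: SL2R_def det_mul matrix_mul_assoc)

lemma inv_SL2R: "det A = 1 \<Longrightarrow> inv\<^bsub>SL2R\<^esub> A = adj2 A"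
  by (rule group.inv_equality[OF group_SL2R]) (auto simp: SL2R_def mult_adj2)

section \<open>The group \<Gamma> and its stabilizer of infinity\<close>

locale level =
  fixes N :: nat and S :: "nat set" and \<Gamma> :: "(real ^ 2 ^ 2) set"
  assumes N: "N \<ge> 1" and S: "\<And>Q. Q \<in> S \<Longrightarrow> exact_divisor Q N"
    and \<Gamma>_def: "\<Gamma> = N_plus_S N S"
begin

lemma generators_normalize:
  assumes "A \<in> Gamma0 N \<union> (\<Union>Q\<in>S. Atkin_Lehner N Q)"
  shows "normalizes A N"
  using assms S N by (auto simp: exact_divisor_def intro: normalizes_Gamma0 normalizes_Atkin_Lehner)

lemma \<Gamma>_normalizes: "A \<in> \<Gamma> \<Longrightarrow> normalizes A N"
  unfolding \<Gamma>_def N_plus_S_def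
proof (induction rule: generate.induct)
  case one
  then show ?case using normalizes_Gamma0[OF Gamma0_one] by (simp add: SL2R_def)
next
  case (incl h)
  then show ?case by (rule generators_normalize)
next
  case (inv h)
  then have "normalizes h N" by (rule generators_normalize)
  then show ?case using inv_SL2R[of h] normalizes_adj2 by (auto simp: normalizes_def)
next
  case (eng h1 h2)
  then show ?case using normalizes_mult by (simp add: SL2R_def)
qed

lemma \<Gamma>_det: "A \<in> \<Gamma> \<Longrightarrow> det A = 1"
  using \<Gamma>_normalizes by (simp add: normalizes_def)

lemma subgroup_\<Gamma>: "subgroup \<Gamma> SL2R"
  unfolding \<Gamma>_def N_plus_S_def
  by (rule group.generate_is_subgroup[OF group_SL2R])
     (use generators_normalize in \<open>auto simp: SL2R_def normalizes_def\<close>)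

lemma \<Gamma>_mult: "A \<in> \<Gamma> \<Longrightarrow> B \<in> \<Gamma> \<Longrightarrow> A ** B \<in> \<Gamma>"
  using subgroup.m_closed[OF subgroup_\<Gamma>] by (simp add: SL2R_def)

lemma \<Gamma>_adj2: "A \<in> \<Gamma> \<Longrightarrow> adj2 A \<in> \<Gamma>"
  using subgroup.m_inv_closed[OF subgroup_\<Gamma>, of A] inv_SL2R[of A] \<Gamma>_det by simp

lemma Gamma0_in_\<Gamma>: "A \<in> Gamma0 N \<Longrightarrow> A \<in> \<Gamma>"
  unfolding \<Gamma>_def N_plus_S_def by (rule generate.incl) simp

text \<open>The conjugates by \<open>A\<close> of the matrix units \<open>e\<^sub>1\<^sub>1\<close> and \<open>e\<^sub>1\<^sub>2\<close> have to be integral.\<close>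

lemma \<Gamma>_stabilizer_infinity:
  assumes A: "A \<in> \<Gamma>" and 0: "m21 A = 0"
  obtains k :: int where "A = mat2 1 (of_int k) 0 1 \<or> A = mat2 (-1) (of_int k) 0 (-1)"
proof -
  define a b d where "a = m11 A" and "b = m12 A" and "d = m22 A"
  have A_eq: "A = mat2 a b 0 d" using 0 by (simp add: mat2_eq_iff a_def b_def d_def)
  have nA: "normalizes A N" using A by (rule \<Gamma>_normalizes)
  then have ad: "a * d = 1" by (simp add: normalizes_def A_eq)
  have e11: "mat2 1 0 0 0 \<in> Eichler_order N" by (rule Eichler_orderI[of _ 1 0 _ 0 0]) simp_all
  have e12: "mat2 0 1 0 0 \<in> Eichler_order N" by (rule Eichler_orderI[of _ 0 1 _ 0 0]) simp_all
  have 1: "A ** mat2 0 1 0 0 ** adj2 A \<in> Eichler_order N"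
      "adj2 A ** mat2 0 1 0 0 ** A \<in> Eichler_order N"
      "A ** mat2 1 0 0 0 ** adj2 A \<in> Eichler_order N"
    using nA e11 e12 by (auto simp: normalizes_def)
  obtain u :: int where u: "a * a = of_int u"
    using 1(1) unfolding A_eq by (auto elim!: Eichler_orderE simp: mat2_eq_iff)
  obtain v :: int where v: "d * d = of_int v"
    using 1(2) unfolding A_eq by (auto elim!: Eichler_orderE simp: mat2_eq_iff)
  obtain w' :: int where "- (a * b) = of_int w'"
    using 1(3) unfolding A_eq by (auto elim!: Eichler_orderE simp: mat2_eq_iff)
  then obtain w :: int where w: "a * b = of_int w"
    by (metis minus_minus of_int_minus)
  \<comment> \<open>The squares of the diagonal entries are integers with product 1, hence equal to
    1.\<close>
  have "real_of_int (u * v) = (a * d) * (a * d)" using u v by (simp add: mult_ac)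
  then have "u * v = 1" using ad by (simp only: mult_1 of_int_eq_1_iff)
  moreover have "u \<ge> 0" using u by (metis of_int_0_le_iff zero_le_square)
  ultimately have "u = 1" using zmult_eq_1_iff by force
  then have "a = 1 \<or> a = - 1" using u by (simp add: square_eq_1_iff)
  then show thesis
  proof
    assume "a = 1"
    then have "A = mat2 1 (of_int w) 0 1" using ad w by (simp add: A_eq)
    then show thesis using that by blast
  next
    assume "a = - 1"
    then have "A = mat2 (- 1) (of_int (- w)) 0 (- 1)" using ad w by (auto simp: A_eq mat2_eq_iff)
    then show thesis using that by blast
  qed
qed

text \<open>The stabilizer consists of integral translations up to sign. In
  \<open>cosets_polar_infinity\<close> this puts the conjugating element into
  \<open>Gamma0 N\<close>, so that it does not change the class.\<close>

lemma \<Gamma>_stabilizer_subset_Gamma0: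
  assumes "A \<in> \<Gamma>" "m21 A = 0"
  shows "A \<in> Gamma0 N"
  using \<Gamma>_stabilizer_infinity[OF assms]
proof cases
  case (1 k)
  then show ?thesis
    using Gamma0_translation[of k] by (auto simp: Gamma0_eq intro: Eichler_orderI[of _ "-1" k _ 0 "-1"])
qed

text \<open>A\<infinity> = \<gamma>\<infinity> means that \<gamma>^-1 A fixes infinity. This lets
  equivalence of cusps be handled through the vanishing of lower left entries.\<close>

lemma infinity_orbit_iff:
  assumes "det A = 1"
  shows "mobius_ext A None \<in> orbit_of \<Gamma> None \<longleftrightarrow> (\<exists>\<gamma>\<in>\<Gamma>. m21 (adj2 \<gamma> ** A) = 0)"
proof -
  have "mobius_ext A None = mobius_ext \<gamma> None \<longleftrightarrow> m21 (adj2 \<gamma> ** A) = 0" if "\<gamma> \<in> \<Gamma>" for \<gamma>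
  proof -
    have "det \<gamma> = 1" using that by (rule \<Gamma>_det)
    then show ?thesis
      using assms by (auto simp: adj2_def mat2_mult_nth det_2 field_simps simp del: of_real_divide)
  qed
  then show ?thesis unfolding orbit_of_def by blast
qed

end

section \<open>The Hecke sum\<close>

text \<open>The matrix acts by an affine map with positive slope, so it only rescales the imaginary
  part.\<close>

lemma at_ioo_compose_upper_triangular:
  assumes h: "h \<in> O[at_ioo](\<lambda>_. 1 :: complex)" and t: "m21 t = 0" "det t > 0"
  shows "(\<lambda>\<tau>. h (mobius t \<tau>)) \<in> O[at_ioo](\<lambda>_. 1 :: complex)"
proof -
  have pos: "m11 t / m22 t > 0"
    using t by (simp add: det_2 zero_less_mult_iff zero_less_divide_iff)
  have Im: "Im (mobius t \<tau>) = m11 t / m22 t * Im \<tau>" for \<tau>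
    by (simp add: mobius_def t Im_divide_of_real)
  obtain c B where B: "\<And>\<tau>. Im \<tau> > c \<Longrightarrow> norm (h \<tau>) \<le> B"
    using h unfolding bigo_ioo_1_iff by blast
  have "norm (h (mobius t \<tau>)) \<le> B" if "Im \<tau> > c / (m11 t / m22 t)" for \<tau>
    using that pos by (intro B) (simp only: Im pos_divide_less_eq mult.commute)
  then show ?thesis unfolding bigo_ioo_1_iff by blast
qed

text \<open>The gcd of \<open>x\<close> and \<open>y\<close> divides p^r and is thus a power of
  \<open>p\<close>. The lemma is applied to a row or a column of an element of norm p^r.\<close>

lemma coprime_if_dvd_prime_power:
  fixes x y z w :: int
  assumes "prime (p :: nat)" "x * z - w * y = int p ^ r" "\<not> (int p dvd x \<and> int p dvd y)"
  shows "coprime x y"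
proof (rule ccontr)
  assume "\<not> coprime x y"
  define g where "g = gcd x y"
  have "g dvd x * z - w * y" by (simp add: g_def)
  then have "nat g dvd p ^ r"
    unfolding assms(2) by (simp add: nat_dvd_iff g_def flip: of_nat_power)
  then obtain i where i: "nat g = p ^ i"
    using divides_primepow_nat[OF assms(1)] by blast
  have "g \<noteq> 1" using \<open>\<not> coprime x y\<close> by (simp add: g_def coprime_iff_gcd_eq_1)
  moreover have "g = int p ^ i" using i by (metis g_def gcd_ge_0_int int_nat_eq of_nat_power)
  ultimately have "int p dvd g" by (cases i) auto
  then show False using assms(3) by (auto simp: g_def)
qed

locale hecke = level +
  fixes p r :: nat and F :: "complex \<Rightarrow> complex"
  assumes p: "prime p"
    and F_hol: "F holomorphic_on upper_half_plane"
    and F_inv: "\<And>A \<tau>. A \<in> \<Gamma> \<Longrightarrow> \<tau> \<in> upper_half_plane \<Longrightarrow> F (mobius A \<tau>) = F \<tau>"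
begin

text \<open>All elements of norm p^r are taken, with no coprimality condition on the diagonal; this
  keeps the set stable under conjugation by \<Gamma>, also when \<open>p\<close> divides
  \<open>N\<close>.\<close>

definition \<Delta> :: "(real ^ 2 ^ 2) set" where
  "\<Delta> = {A \<in> Eichler_order N. det A = real (p ^ r)}"

definition coset :: "real ^ 2 ^ 2 \<Rightarrow> (real ^ 2 ^ 2) set" where
  "coset x = (\<lambda>A. A ** x) ` Gamma0 N"

definition rep :: "(real ^ 2 ^ 2) set \<Rightarrow> real ^ 2 ^ 2" where
  "rep C = (SOME x. x \<in> C)"

definition hecke_sum :: "complex \<Rightarrow> complex" where
  "hecke_sum \<tau> = (\<Sum>C\<in>coset ` \<Delta>. F (mobius (rep C) \<tau>))"

definition shift :: "nat \<Rightarrow> real ^ 2 ^ 2" where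
  "shift i = mat2 1 (real i / real p) 0 1"

lemma p_pos: "p > 0"
  using p prime_gt_0_nat by blast

lemma coset_self: "x \<in> coset x"
  unfolding coset_def using Gamma0_one by (metis image_eqI matrix_mul_lid)

lemma coset_mult: "A \<in> Gamma0 N \<Longrightarrow> coset (A ** x) = coset x"
proof -
  assume A: "A \<in> Gamma0 N"
  have "B ** x = (B ** adj2 A) ** (A ** x)" for B
    using adj2_cancel(2)[OF Gamma0_det[OF A], of x] by (simp add: matrix_mul_assoc[symmetric])
  then show ?thesis
    unfolding coset_def using A Gamma0_mult Gamma0_adj2
    by (auto simp: matrix_mul_assoc image_iff) blast
qed

lemma coset_eqD: "coset x = coset y \<Longrightarrow> \<exists>A\<in>Gamma0 N. x = A ** y"
  using coset_self[of x] unfolding coset_def by auto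

lemma rep_coset: "\<exists>A\<in>Gamma0 N. rep (coset x) = A ** x"
  using someI[of "\<lambda>y. y \<in> coset x", OF coset_self] unfolding rep_def coset_def by blast

lemma coset_rep: "coset (rep (coset x)) = coset x"
  using rep_coset[of x] coset_mult by auto

lemma \<Delta>_mult: "A \<in> Gamma0 N \<Longrightarrow> x \<in> \<Delta> \<Longrightarrow> A ** x \<in> \<Delta>"
  by (simp add: \<Delta>_def Gamma0_eq Eichler_order_mult det_mul)

lemma \<Delta>_det: "x \<in> \<Delta> \<Longrightarrow> det x > 0"
  using p_pos by (simp add: \<Delta>_def)

lemma F_Gamma0: "A \<in> Gamma0 N \<Longrightarrow> det x > 0 \<Longrightarrow> \<tau> \<in> upper_half_plane \<Longrightarrow>
    F (mobius (A ** x) \<tau>) = F (mobius x \<tau>)"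
  by (simp add: mobius_mult Gamma0_det F_inv Gamma0_in_\<Gamma> mobius_in_upper_half_plane)

lemma F_rep_coset: "x \<in> \<Delta> \<Longrightarrow> \<tau> \<in> upper_half_plane \<Longrightarrow> F (mobius (rep (coset x)) \<tau>) = F (mobius x \<tau>)"
  using rep_coset[of x] F_Gamma0 \<Delta>_det by metis

text \<open>The class of a matrix is determined by its parameters modulo N p^r: if x and y agree
  modulo this number, then x y^-1 is the identity plus N times an element of the order, hence in
  \<open>Gamma0 N\<close>.\<close>

lemma finite_cosets: "finite (coset ` \<Delta>)"
proof -
  define M where "M = int (N * p ^ r)"
  have M: "M > 0" using N p_pos by (simp add: M_def)
  define mat where "mat = (\<lambda>(a, b, c, d). mat2 (of_int a) (of_int b) (of_int (int N * c)) (of_int d))"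
  define I where "I = {x :: int \<times> int \<times> int \<times> int. mat x \<in> \<Delta>}"
  define res where "res = (\<lambda>(a, b, c, d). (a mod M, b mod M, c mod M, d mod M))"
  have "\<Delta> \<subseteq> mat ` I"
  proof
    fix x assume "x \<in> \<Delta>"
    moreover from this obtain a b c d where "x = mat (a, b, c, d)"
      unfolding \<Delta>_def mat_def by (auto elim: Eichler_orderE)
    ultimately show "x \<in> mat ` I" by (auto simp: I_def)
  qed
  then have img: "coset ` \<Delta> = (\<lambda>x. coset (mat x)) ` I"
    by (auto simp: I_def)
  have res: "coset (mat x) = coset (mat y)" if x: "x \<in> I" and y: "y \<in> I" and eq: "res x = res y" for x y
  proof -
    obtain a b c d where xs: "x = (a, b, c, d)" by (cases x)
    obtain a' b' c' d' where ys: "y = (a', b', c', d')" by (cases y)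
    have "M dvd a - a'" "M dvd b - b'" "M dvd c - c'" "M dvd d - d'"
      using eq unfolding res_def xs ys by (auto simp: mod_eq_dvd_iff)
    then obtain \<alpha> \<beta> \<gamma> \<delta> where eqs: "a = a' + M * \<alpha>" "b = b' + M * \<beta>" "c = c' + M * \<gamma>" "d = d' + M * \<delta>"
      unfolding dvd_def by (metis diff_add_cancel add.commute)
    \<comment> \<open>This is x y^-1 = 1 + (x - y) adj(y) / p^r written out; the factor N p^r of x -
      y cancels the denominator.\<close>
    define B where "B = mat2 (of_int (1 + int N * (\<alpha> * d' - \<beta> * int N * c')))
      (of_int (int N * (\<beta> * a' - \<alpha> * b'))) (of_int (int N * (int N * (\<gamma> * d' - \<delta> * c'))))
      (of_int (1 + int N * (\<delta> * a' - int N * \<gamma> * b')))"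
    have det_y: "of_int a' * of_int d' - of_int b' * (real N * of_int c') = real p ^ r"
      using y by (simp add: I_def mat_def ys \<Delta>_def)
    have "B ** mat y = mat x"
    proof -
      have 1: "real N * (u * d' - v * real N * c') * a' + real N * (v * a' - u * b') * (real N * c')
          = real N * u * (a' * d' - b' * (real N * c'))" for u v a' b' c' d' :: real
        by (simp add: algebra_simps)
      have 2: "real N * (u * d' - v * real N * c') * b' + real N * (v * a' - u * b') * d'
          = real N * v * (a' * d' - b' * (real N * c'))" for u v a' b' c' d' :: real
        by (simp add: algebra_simps)
      have 3: "real N * (real N * (u * d' - v * c')) * a' + real N * (v * a' - real N * u * b') * (real N * c')
          = real N * real N * u * (a' * d' - b' * (real N * c'))" for u v a' b' c' d' :: real
        by (simp add: algebra_simps)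
      have 4: "real N * (real N * (u * d' - v * c')) * b' + real N * (v * a' - real N * u * b') * d'
          = real N * v * (a' * d' - b' * (real N * c'))" for u v a' b' c' d' :: real
        by (simp add: algebra_simps)
      show ?thesis
        unfolding mat_def xs ys B_def eqs prod.case mat2_mult
        using 1[of "of_int \<alpha>" "of_int d'" "of_int \<beta>" "of_int c'" "of_int a'" "of_int b'"]
          2[of "of_int \<alpha>" "of_int d'" "of_int \<beta>" "of_int c'" "of_int b'" "of_int a'"]
          3[of "of_int \<gamma>" "of_int d'" "of_int \<delta>" "of_int c'" "of_int a'" "of_int b'"]
          4[of "of_int \<gamma>" "of_int d'" "of_int \<delta>" "of_int c'" "of_int b'" "of_int a'"]
        unfolding det_y
        by (simp add: mat2_eq_iff M_def distrib_right distrib_left) 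
    qed
    moreover have "B \<in> Gamma0 N"
    proof -
      have "det B * det (mat y) = det (mat x)"
        using \<open>B ** mat y = mat x\<close> by (metis det_mul)
      then have "det B = 1"
        using x y p_pos by (simp add: I_def \<Delta>_def)
      moreover have "B \<in> Eichler_order N"
        unfolding B_def by (rule Eichler_orderI) (rule mat2_nth)+
      ultimately show ?thesis by (simp add: Gamma0_eq)
    qed
    ultimately show ?thesis by (metis coset_mult)
  qed
  have "res ` I \<subseteq> {0..<M} \<times> {0..<M} \<times> {0..<M} \<times> {0..<M}"
    using M by (auto simp: res_def)
  then have "finite (res ` I)" by (rule finite_subset) simp
  \<comment> \<open>A chosen matrix in each residue class makes the set of cosets an image of the
    finite set of residues.\<close>
  moreover have "(\<lambda>x. coset (mat x)) ` I = (\<lambda>s. coset (mat (SOME x. x \<in> I \<and> res x = s))) ` (res ` I)"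
  proof -
    have "coset (mat x) = coset (mat (SOME y. y \<in> I \<and> res y = res x))" if "x \<in> I" for x
    proof -
      have "(SOME y. y \<in> I \<and> res y = res x) \<in> I \<and> res (SOME y. y \<in> I \<and> res y = res x) = res x"
        by (rule someI[of _ x]) (use that in blast)
      then show ?thesis by (intro res that) simp_all
    qed
    then have "(\<lambda>x. coset (mat x)) ` I = (\<lambda>x. coset (mat (SOME y. y \<in> I \<and> res y = res x))) ` I"
      by (rule image_cong[OF refl])
    also have "\<dots> = (\<lambda>s. coset (mat (SOME x. x \<in> I \<and> res x = s))) ` (res ` I)"
      by (simp only: image_image)
    finally show ?thesis .
  qed
  ultimately show ?thesis unfolding img by simp
qed

text \<open>These are the unions of classes inside \<Delta>; the Hecke sum is decomposed along such
  sets.\<close>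

definition saturated :: "(real ^ 2 ^ 2) set \<Rightarrow> bool" where
  "saturated X \<longleftrightarrow> X \<subseteq> \<Delta> \<and> (\<forall>A\<in>Gamma0 N. \<forall>x\<in>X. A ** x \<in> X)"

lemma rep_in_saturated: "saturated X \<Longrightarrow> C \<in> coset ` X \<Longrightarrow> rep C \<in> X"
  using rep_coset unfolding saturated_def by (metis imageE)

lemma saturated_Diff:
  assumes "saturated X" "saturated Y"
  shows "saturated (X - Y)"
proof -
  have "A ** x \<notin> Y" if "A \<in> Gamma0 N" "x \<notin> Y" for A x
    using that assms(2) Gamma0_adj2[OF that(1)] adj2_cancel(2)[OF Gamma0_det[OF that(1)], of x]
    unfolding saturated_def by metis
  then show ?thesis using assms unfolding saturated_def by blast
qed

lemma saturated_\<Delta>: "saturated \<Delta>"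
  using \<Delta>_mult by (simp add: saturated_def)

lemma sum_cosets_split:
  fixes h :: "real ^ 2 ^ 2 \<Rightarrow> complex"
  assumes "saturated X" "saturated Y" "Y \<subseteq> X"
  shows "(\<Sum>C\<in>coset ` X. h (rep C)) = (\<Sum>C\<in>coset ` Y. h (rep C)) + (\<Sum>C\<in>coset ` (X - Y). h (rep C))"
proof -
  have fin: "finite (coset ` X)" if "saturated X" for X
    using that finite_subset[OF _ finite_cosets] unfolding saturated_def by (meson image_mono)
  have "coset ` Y \<inter> coset ` (X - Y) = {}"
    using rep_in_saturated[OF assms(2)] rep_in_saturated[OF saturated_Diff[OF assms(1,2)]] by blast
  moreover have "coset ` X = coset ` Y \<union> coset ` (X - Y)" using assms(3) by blast
  ultimately show ?thesis
    using fin assms(2) saturated_Diff[OF assms(1,2)] by (simp add: sum.union_disjoint)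
qed

text \<open>The map \<open>\<psi>\<close> is applied to representatives only and need not respect
  classes, so it may depend on choices. It induces an injective self-map of a finite set of classes,
  hence a bijection.\<close>

lemma sum_cosets_permute:
  fixes h :: "real ^ 2 ^ 2 \<Rightarrow> complex"
  assumes X: "saturated X"
    and \<psi>: "\<And>x. x \<in> X \<Longrightarrow> \<psi> x \<in> X"
    and inj: "\<And>x y. x \<in> X \<Longrightarrow> y \<in> X \<Longrightarrow> coset (\<psi> x) = coset (\<psi> y) \<Longrightarrow> coset x = coset y"
    and h: "\<And>A x. A \<in> Gamma0 N \<Longrightarrow> x \<in> X \<Longrightarrow> h (A ** x) = h x"
  shows "(\<Sum>C\<in>coset ` X. h (\<psi> (rep C))) = (\<Sum>C\<in>coset ` X. h (rep C))"
proof -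
  define \<phi> where "\<phi> C = coset (\<psi> (rep C))" for C
  have fin: "finite (coset ` X)"
    using X finite_subset[OF _ finite_cosets] unfolding saturated_def by (meson image_mono)
  have rp: "rep C \<in> X" if "C \<in> coset ` X" for C
    using rep_in_saturated[OF X that] .
  have maps: "\<phi> ` (coset ` X) \<subseteq> coset ` X"
    using rp \<psi> by (auto simp: \<phi>_def)
  have "inj_on \<phi> (coset ` X)"
  proof (rule inj_onI)
    fix C D assume C: "C \<in> coset ` X" and D: "D \<in> coset ` X" and eq: "\<phi> C = \<phi> D"
    have "coset (rep C) = coset (rep D)"
      by (rule inj[OF rp[OF C] rp[OF D] eq[unfolded \<phi>_def]])
    moreover have "coset (rep E) = E" if "E \<in> coset ` X" for E
    proof -
      obtain x where "E = coset x" using \<open>E \<in> coset ` X\<close> by blast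
      then show ?thesis by (simp only: coset_rep)
    qed
    ultimately show "C = D" using C D by metis
  qed
  then have "bij_betw \<phi> (coset ` X) (coset ` X)"
    using endo_inj_surj[OF fin maps] by (simp add: bij_betw_def)
  then have "(\<Sum>C\<in>coset ` X. h (rep C)) = (\<Sum>C\<in>coset ` X. h (rep (\<phi> C)))"
    by (rule sum.reindex_bij_betw[symmetric])
  also have "\<dots> = (\<Sum>C\<in>coset ` X. h (\<psi> (rep C)))"
  proof (intro sum.cong refl)
    fix C assume "C \<in> coset ` X"
    then have "\<psi> (rep C) \<in> X" using rp \<psi> by blast
    then show "h (rep (\<phi> C)) = h (\<psi> (rep C))"
      using rep_coset[of "\<psi> (rep C)"] h unfolding \<phi>_def by auto
  qed
  finally show ?thesis ..
qed

lemma rep_\<Delta>: "C \<in> coset ` \<Delta> \<Longrightarrow> rep C \<in> \<Delta>"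
  using rep_in_saturated[OF saturated_\<Delta>] .

lemma hecke_sum_holomorphic: "hecke_sum holomorphic_on upper_half_plane"
proof -
  have "(\<lambda>\<tau>. F (mobius x \<tau>)) holomorphic_on upper_half_plane" if "det x > 0" for x
    using holomorphic_on_compose_gen[OF mobius_holomorphic[OF that] F_hol] mobius_in_upper_half_plane[OF that]
    by (auto simp: o_def)
  then have "(\<lambda>\<tau>. \<Sum>C\<in>coset ` \<Delta>. F (mobius (rep C) \<tau>)) holomorphic_on upper_half_plane"
    by (intro holomorphic_on_sum) (use rep_\<Delta> \<Delta>_det in blast)
  then show ?thesis by (simp add: hecke_sum_def[abs_def])
qed

text \<open>Conjugation x \<mapsto> A^-1 x A permutes the classes, because \<open>A\<close>
  normalizes the order and with it \<open>Gamma0 N\<close>. In x A = A (A^-1 x A) the outer factor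
  \<open>A\<close> is absorbed by the invariance of \<open>F\<close>.\<close>

lemma hecke_sum_invariant:
  assumes A: "A \<in> \<Gamma>" and \<tau>: "\<tau> \<in> upper_half_plane"
  shows "hecke_sum (mobius A \<tau>) = hecke_sum \<tau>"
proof -
  have det_A: "det A = 1" using A by (rule \<Gamma>_det)
  have conj: "A ** (adj2 A ** x ** A) = x ** A" for x
    using adj2_cancel(1)[OF det_A] by (simp add: matrix_mul_assoc[symmetric])
  have conj': "adj2 A ** x ** A \<in> \<Delta>" if "x \<in> \<Delta>" for x
    using \<Gamma>_normalizes[OF A] that by (simp add: normalizes_def \<Delta>_def det_mul)
  have "F (mobius x (mobius A \<tau>)) = F (mobius (adj2 A ** x ** A) \<tau>)" if x: "x \<in> \<Delta>" for x
  proof -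
    have "mobius x (mobius A \<tau>) = mobius A (mobius (adj2 A ** x ** A) \<tau>)"
      using \<Delta>_det[OF x] \<Delta>_det[OF conj'[OF x]] det_A \<tau> conj[of x] by (metis mobius_mult zero_less_one)
    then show ?thesis
      using F_inv[OF A mobius_in_upper_half_plane[OF \<Delta>_det[OF conj'[OF x]] \<tau>]] by simp
  qed
  then have "hecke_sum (mobius A \<tau>) = (\<Sum>C\<in>coset ` \<Delta>. F (mobius (adj2 A ** rep C ** A) \<tau>))"
    unfolding hecke_sum_def by (intro sum.cong refl) (use rep_\<Delta> in blast)
  also have "\<dots> = (\<Sum>C\<in>coset ` \<Delta>. F (mobius (rep C) \<tau>))"
  proof (rule sum_cosets_permute[where h = "\<lambda>x. F (mobius x \<tau>)" and \<psi> = "\<lambda>x. adj2 A ** x ** A"])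
    fix x y assume "coset (adj2 A ** x ** A) = coset (adj2 A ** y ** A)"
    then obtain B where B: "B \<in> Gamma0 N" "adj2 A ** x ** A = B ** (adj2 A ** y ** A)"
      using coset_eqD by blast
    then have "x ** A = A ** B ** (adj2 A ** y ** A)"
      by (metis conj matrix_mul_assoc)
    also have "\<dots> = (A ** B ** adj2 A) ** y ** A"
      by (simp add: matrix_mul_assoc)
    finally have "x = (A ** B ** adj2 A) ** y"
      by (rule mult_left_cancel_det) (simp add: det_A)
    moreover have "A ** B ** adj2 A \<in> Gamma0 N"
      using \<Gamma>_normalizes[OF A] B(1) by (simp add: normalizes_def Gamma0_eq det_mul)
    ultimately show "coset x = coset y" by (metis coset_mult)
  qed (use saturated_\<Delta> conj' F_Gamma0 \<Delta>_det \<tau> in auto)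
  finally show ?thesis by (simp add: hecke_sum_def)
qed

end

section \<open>Right translations by 1/p and the coefficients of index prime to p\<close>

context hecke
begin

lemma det_shift [simp]: "det (shift i) = 1"
  by (simp add: shift_def)

lemma mobius_shift: "mobius (shift i) \<tau> = \<tau> + of_real (real i / real p)"
  by (simp add: mobius_def shift_def)

lemma shift_mult_shift: "shift i ** shift j = shift (i + j)"
  by (simp add: shift_def add_divide_distrib add.commute)

text \<open>The product \<open>shift i ** x\<close> is affine in \<open>i\<close>, so integrality at
  i = 0 and i = 1 gives it for all \<open>i\<close>.\<close>

lemma shift_mult_in_order:
  assumes "x \<in> Eichler_order N" "shift 1 ** x \<in> Eichler_order N"
  shows "shift i ** x \<in> Eichler_order N"
proof -
  have "x + of_int (int i) *\<^sub>R (shift 1 ** x - x) = shift i ** x"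
    by (simp add: mat2_eq_iff mat2_mult_nth shift_def)
  then show ?thesis using Eichler_order_add_scale[OF assms, of "int i"] by simp
qed

lemma mult_shift_in_order:
  assumes "x \<in> Eichler_order N" "x ** shift 1 \<in> Eichler_order N"
  shows "x ** shift i \<in> Eichler_order N"
proof -
  have "x + of_int (int i) *\<^sub>R (x ** shift 1 - x) = x ** shift i"
    by (simp add: mat2_eq_iff mat2_mult_nth shift_def)
  then show ?thesis using Eichler_order_add_scale[OF assms, of "int i"] by simp
qed

definition right_stable :: "(real ^ 2 ^ 2) set" where
  "right_stable = {x \<in> \<Delta>. x ** shift 1 \<in> Eichler_order N}"

lemma saturated_right_stable: "saturated right_stable"
  using \<Delta>_mult Eichler_order_mult
  by (auto simp: saturated_def right_stable_def Gamma0_eq matrix_mul_assoc[symmetric])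

lemma sum_right_stable_periodic:
  assumes \<tau>: "\<tau> \<in> upper_half_plane"
  shows "(\<Sum>C\<in>coset ` right_stable. F (mobius (rep C) (\<tau> + of_real (1 / real p)))) =
         (\<Sum>C\<in>coset ` right_stable. F (mobius (rep C) \<tau>))"
proof -
  have det: "det x > 0" if "x \<in> right_stable" for x
    using that \<Delta>_det by (simp add: right_stable_def)
  have "F (mobius (rep C) (\<tau> + of_real (1 / real p))) = F (mobius (rep C ** shift 1) \<tau>)"
    if "C \<in> coset ` right_stable" for C
    using \<tau> det[OF rep_in_saturated[OF saturated_right_stable that]] mobius_shift[of 1 \<tau>]
    by (simp add: mobius_mult)
  then have "(\<Sum>C\<in>coset ` right_stable. F (mobius (rep C) (\<tau> + of_real (1 / real p)))) =
      (\<Sum>C\<in>coset ` right_stable. F (mobius (rep C ** shift 1) \<tau>))"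
    by (rule sum.cong[OF refl])
  also have "\<dots> = (\<Sum>C\<in>coset ` right_stable. F (mobius (rep C) \<tau>))"
  proof (rule sum_cosets_permute[where h = "\<lambda>x. F (mobius x \<tau>)" and \<psi> = "\<lambda>x. x ** shift 1"])
    fix x assume "x \<in> right_stable"
    \<comment> \<open>Stability of \<open>x ** shift 1\<close> asks for \<open>x ** shift 2\<close>
      in the order.\<close>
    then show "x ** shift 1 \<in> right_stable"
      using mult_shift_in_order[of x 2]
      by (simp add: right_stable_def \<Delta>_def det_mul matrix_mul_assoc[symmetric] shift_mult_shift numeral_2_eq_2)
  next
    fix x y assume "coset (x ** shift 1) = coset (y ** shift 1)"
    then obtain B where B: "B \<in> Gamma0 N" "x ** shift 1 = (B ** y) ** shift 1"
      using coset_eqD by (metis matrix_mul_assoc)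
    then have "x = B ** y" by (intro mult_left_cancel_det[OF B(2)]) simp
    then show "coset x = coset y" using B(1) coset_mult by simp
  qed (use saturated_right_stable det F_Gamma0 \<tau> in auto)
  finally show ?thesis .
qed

text \<open>If right stability fails, then \<open>p\<close> does not divide both entries of the
  first column, which is primitive because the determinant is a power of \<open>p\<close>. An
  element of \<open>Gamma0 N\<close> turns this column into (1, 0), and integral translations reduce
  the upper right entry modulo p^r.\<close>

lemma cosets_not_right_stable:
  "coset ` (\<Delta> - right_stable) = (\<lambda>b. coset (mat2 1 (real b) 0 (real (p ^ r)))) ` {..<p ^ r}"
proof (intro equalityI subsetI)
  fix C assume "C \<in> coset ` (\<Delta> - right_stable)"
  then obtain x where x: "C = coset x" "x \<in> \<Delta>" "x ** shift 1 \<notin> Eichler_order N"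
    by (auto simp: right_stable_def)
  obtain a b c d where x_eq: "x = mat2 (of_int a) (of_int b) (of_int (int N * c)) (of_int d)"
    using x(2) by (auto simp: \<Delta>_def elim: Eichler_orderE)
  have "real_of_int (a * d - b * (int N * c)) = of_int (int (p ^ r))"
    using x(2) by (simp add: \<Delta>_def x_eq)
  then have det: "a * d - b * (int N * c) = int p ^ r"
    by (simp only: of_int_eq_iff of_nat_power)
  have "\<not> (int p dvd a \<and> int p dvd int N * c)"
  proof
    assume "int p dvd a \<and> int p dvd int N * c"
    then obtain a' c' where "a = int p * a'" "int N * c = int p * c'" by (auto elim!: dvdE)
    then have a': "real_of_int a = real p * of_int a'" and c': "real N * real_of_int c = real p * of_int c'"
      by (metis of_int_mult of_int_of_nat_eq)+
    have "x ** shift 1 \<in> Eichler_order N"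
      using p_pos a' c' by (intro Eichler_orderI[of _ a "b + a'" _ c "d + c'"]) (simp_all add: x_eq shift_def)
    with x(3) show False by simp
  qed
  then have "coprime a (int N * c)"
    by (rule coprime_if_dvd_prime_power[OF p det])
  then obtain u v where uv: "u * a + v * (int N * c) = 1"
    by (metis bezout_int coprime_iff_gcd_eq_1)
  \<comment> \<open>By Bezout, \<open>G\<close> has determinant 1 and sends the first column (a, N
    c) of \<open>x\<close> to (1, 0).\<close>
  define G where "G = mat2 (of_int u) (of_int v) (of_int (int N * (- c))) (of_int a)"
  have G: "G \<in> Gamma0 N"
  proof -
    have "real_of_int (u * a + v * (int N * c)) = 1" unfolding uv by simp
    then have "det G = 1" by (simp add: G_def algebra_simps)
    moreover have "G \<in> Eichler_order N" unfolding G_def by (rule Eichler_orderI) (rule mat2_nth)+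
    ultimately show ?thesis by (simp add: Gamma0_eq)
  qed
  define e where "e = u * b + v * d"
  have Gx: "G ** x = mat2 1 (of_int e) 0 (real (p ^ r))"
  proof -
    have "real_of_int (u * a + v * (int N * c)) = 1" unfolding uv by simp
    moreover have "real_of_int (a * d - b * (int N * c)) = real p ^ r" unfolding det by simp
    ultimately show ?thesis by (simp add: G_def x_eq e_def algebra_simps)
  qed
  define k where "k = - (e div int (p ^ r))"
  define b' where "b' = nat (e mod int (p ^ r))"
  have P: "int (p ^ r) > 0" using p_pos by simp
  have b': "int b' = e + k * int (p ^ r)"
    using P pos_mod_sign[OF P, of e] minus_div_mult_eq_mod[of e "int (p ^ r)"] by (simp add: b'_def k_def)
  have "real_of_int (int b') = of_int e + of_int k * real (p ^ r)"
    unfolding b' by simp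
  then have "real b' = of_int e + of_int k * real (p ^ r)" by simp
  then have "mat2 1 (of_int k) 0 1 ** (G ** x) = mat2 1 (real b') 0 (real (p ^ r))"
    by (simp add: Gx)
  then have "coset (mat2 1 (real b') 0 (real (p ^ r))) = coset x"
    using coset_mult Gamma0_translation G by metis
  moreover have "b' < p ^ r"
    using P by (simp add: b'_def nat_less_iff)
  ultimately show "C \<in> (\<lambda>b. coset (mat2 1 (real b) 0 (real (p ^ r)))) ` {..<p ^ r}"
    using x(1) by blast
next
  fix C assume "C \<in> (\<lambda>b. coset (mat2 1 (real b) 0 (real (p ^ r)))) ` {..<p ^ r}"
  then obtain b where C: "C = coset (mat2 1 (real b) 0 (real (p ^ r)))" by blast
  have "mat2 1 (real b) 0 (real (p ^ r)) \<in> \<Delta>"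
    by (auto simp: \<Delta>_def intro: Eichler_orderI[of _ 1 "int b" _ 0 "int (p ^ r)"])
  moreover have "mat2 1 (real b) 0 (real (p ^ r)) ** shift 1 \<notin> Eichler_order N"
  proof
    assume "mat2 1 (real b) 0 (real (p ^ r)) ** shift 1 \<in> Eichler_order N"
    then obtain k :: int where "1 / real p + real b = of_int k"
      by (auto elim!: Eichler_orderE simp: shift_def mat2_eq_iff)
    then have "1 = real_of_int ((k - int b) * int p)"
      using p_pos by (simp add: field_simps)
    then have "(k - int b) * int p = 1" by (simp only: of_int_eq_1_iff)
    then have "int p dvd 1" by (metis dvd_triv_right)
    then show False using p prime_gt_1_nat[of p] by simp
  qed
  ultimately show "C \<in> coset ` (\<Delta> - right_stable)"
    using C by (auto simp: right_stable_def)
qed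

text \<open>Distinct b in the range 0 \<le> b < p^r give distinct classes, so this part of the Hecke
  sum is the one evaluated by \<open>q_series_U\<close>.\<close>

lemma sum_not_right_stable:
  assumes \<tau>: "\<tau> \<in> upper_half_plane"
  shows "(\<Sum>C\<in>coset ` (\<Delta> - right_stable). F (mobius (rep C) \<tau>)) =
         (\<Sum>b<p ^ r. F ((\<tau> + of_nat b) / of_nat (p ^ r)))"
proof -
  have P: "real (p ^ r) > 0" using p_pos by simp
  have inj: "inj_on (\<lambda>b. coset (mat2 1 (real b) 0 (real (p ^ r)))) {..<p ^ r}"
  proof (rule inj_onI)
    fix b b' assume b: "b \<in> {..<p ^ r}" "b' \<in> {..<p ^ r}"
      and "coset (mat2 1 (real b) 0 (real (p ^ r))) = coset (mat2 1 (real b') 0 (real (p ^ r)))"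
    then obtain A where "A \<in> Gamma0 N" "mat2 1 (real b) 0 (real (p ^ r)) = A ** mat2 1 (real b') 0 (real (p ^ r))"
      using coset_eqD by blast
    moreover from this obtain x y z w :: int where "A = mat2 (of_int x) (of_int y) (of_int (int N * z)) (of_int w)"
      by (auto simp: Gamma0_eq elim: Eichler_orderE)
    ultimately have "real b = real b' + of_int y * real (p ^ r)"
      by (simp add: mat2_eq_iff)
    then have "real_of_int (int b) = of_int (int b' + y * int (p ^ r))" by simp
    then have "int b = int b' + y * int (p ^ r)" by (simp only: of_int_eq_iff)
    then have "int b mod int (p ^ r) = int b' mod int (p ^ r)"
      by (simp only: mod_mult_self1)
    then have "b mod p ^ r = b' mod p ^ r"
      by (simp only: of_nat_mod[symmetric] of_nat_eq_iff)
    then show "b = b'" using b by simp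
  qed
  have "F (mobius (rep (coset (mat2 1 (real b) 0 (real (p ^ r))))) \<tau>) = F ((\<tau> + of_nat b) / of_nat (p ^ r))" for b
  proof -
    have "mat2 1 (real b) 0 (real (p ^ r)) \<in> \<Delta>"
      by (auto simp: \<Delta>_def intro: Eichler_orderI[of _ 1 "int b" _ 0 "int (p ^ r)"])
    from F_rep_coset[OF this \<tau>] show ?thesis by (simp add: mobius_def)
  qed
  then show ?thesis
    unfolding cosets_not_right_stable by (subst sum.reindex[OF inj]) (simp only: o_def)
qed

text \<open>Translation by 1 / p fixes the right-stable part and multiplies its \<open>n\<close>-th
  coefficient by exp (2 pi i n / p), which is not 1. So this coefficient is 0 and only the other
  classes count.\<close>

lemma hecke_sum_coefficient:
  assumes F: "q_series c F" and G: "q_series e hecke_sum" and n: "\<not> int p dvd n"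
  shows "e n = of_nat (p ^ r) * c (int (p ^ r) * n)"
proof -
  define U where "U = (\<lambda>\<tau>. \<Sum>b<p ^ r. F ((\<tau> + of_nat b) / of_nat (p ^ r)))"
  have U: "q_series (\<lambda>k. of_nat (p ^ r) * c (int (p ^ r) * k)) U"
    unfolding U_def by (rule q_series_U[OF F]) (use p_pos in simp)
  define R where "R = (\<lambda>\<tau>. \<Sum>C\<in>coset ` right_stable. F (mobius (rep C) \<tau>))"
  have "hecke_sum \<tau> = R \<tau> + U \<tau>" if "\<tau> \<in> upper_half_plane" for \<tau>
    unfolding hecke_sum_def R_def U_def sum_not_right_stable[OF that, symmetric]
    by (rule sum_cosets_split[OF saturated_\<Delta> saturated_right_stable]) (simp add: right_stable_def)
  then have R: "q_series (\<lambda>k. e k - of_nat (p ^ r) * c (int (p ^ r) * k)) R"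
    by (intro q_series_cong[OF q_series_diff[OF G U]]) auto
  let ?d = "\<lambda>k. e k - of_nat (p ^ r) * c (int (p ^ r) * k)"
  have "q_series (\<lambda>k. ?d k * nome (of_int k * of_real (1 / real p))) R"
    by (rule q_series_cong[OF q_series_translate[OF R, of "1 / real p"]])
       (simp_all only: R_def sum_right_stable_periodic)
  from q_series_unique[OF this R]
  have "?d n * nome (of_int n * of_real (1 / real p)) = ?d n" by (rule fun_cong)
  moreover have "nome (of_int n * of_real (1 / real p)) \<noteq> 1"
  proof
    assume "nome (of_int n * of_real (1 / real p)) = 1"
    then obtain k :: int where "of_int n * of_real (1 / real p) = (of_int k :: complex)"
      unfolding nome_eq_1_iff by (auto elim: Ints_cases)
    then have "(of_int n :: complex) = of_int (k * int p)"
      using p_pos by (simp add: field_simps)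
    then have "n = k * int p" by (simp only: of_int_eq_iff)
    then show False using n by simp
  qed
  ultimately show ?thesis by simp
qed

end

section \<open>Cusps\<close>

text \<open>The first column of \<open>X\<close>, divided by its gcd, is completed to a matrix
  \<open>B\<close> in SL2(Z); then B\<infinity> = X\<infinity>.\<close>

lemma SL2Z_upper_triangular:
  assumes X: "X \<in> Eichler_order 1" and det: "det X > 0"
  obtains B where "B \<in> Gamma0 1" "m21 (adj2 B ** X) = 0"
proof -
  obtain a b c d where X_eq: "X = mat2 (of_int a) (of_int b) (of_int c) (of_int d)"
    using X by (auto elim: Eichler_orderE)
  have "a \<noteq> 0 \<or> c \<noteq> 0" using det by (auto simp: X_eq)
  then obtain a' c' g where a': "a = a' * g" "c = c' * g" "coprime a' c'"
    using gcd_coprime_exists[of a c] by auto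
  obtain u v where uv: "u * a' + v * c' = 1"
    using a'(3) by (metis bezout_int coprime_iff_gcd_eq_1)
  define B where "B = mat2 (of_int a') (of_int (- v)) (of_int (int 1 * c')) (of_int u)"
  have "B \<in> Eichler_order 1" unfolding B_def by (rule Eichler_orderI) (rule mat2_nth)+
  moreover have "real_of_int (u * a' + v * c') = 1" unfolding uv by simp
  then have "det B = 1" by (simp add: B_def algebra_simps)
  ultimately have "B \<in> Gamma0 1" by (simp add: Gamma0_eq)
  moreover have "a' * c = c' * a"
    unfolding a' by simp
  then have "real_of_int (a' * c) = of_int (c' * a)" by simp
  then have "m21 (adj2 B ** X) = 0" by (simp add: B_def X_eq mat2_mult_nth)
  ultimately show thesis by (rule that)
qed

lemma Eichler_order_subset_1: "A \<in> Eichler_order N \<Longrightarrow> A \<in> Eichler_order 1"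
proof (elim Eichler_orderE)
  fix a b c d assume "A = mat2 (of_int a) (of_int b) (of_int (int N * c)) (of_int d)"
  then show ?thesis by (intro Eichler_orderI[of A a b 1 "int N * c" d]) simp_all
qed

lemma m21_mult_upper_triangular: "m21 A = 0 \<Longrightarrow> m21 B = 0 \<Longrightarrow> m21 (A ** B) = 0"
  by (simp add: mat2_mult_nth)

text \<open>\<open>F_cusp\<close> confines the poles of \<open>F\<close> to the orbit of infinity.
  \<open>F_trace\<close> says that the part of the expansion at infinity with exponents divisible by
  \<open>p\<close> is bounded.\<close>

locale hecke_cusp = hecke +
  assumes F_cusp: "\<And>B. B \<in> Gamma0 1 \<Longrightarrow> mobius_ext B None \<notin> orbit_of \<Gamma> None \<Longrightarrow>
      (\<lambda>\<tau>. F (mobius B \<tau>)) \<in> O[at_ioo](\<lambda>_. 1)"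
    and F_trace: "(\<lambda>\<tau>. \<Sum>i<p. F (\<tau> + of_real (real i / real p))) \<in> O[at_ioo](\<lambda>_. 1)"
begin

text \<open>
  Those \<open>y\<close> in \<open>\<Delta>\<close> for which \<open>y A \<infinity>\<close> is a pole of \<open>F\<close>, and among them those that are
  mapped into \<open>\<Delta>\<close> by the conjugates of the translations by \<open>i / p\<close> that fix this pole.
\<close>

definition polar :: "real ^ 2 ^ 2 \<Rightarrow> (real ^ 2 ^ 2) set" where
  "polar A = {y \<in> \<Delta>. \<exists>\<gamma>\<in>\<Gamma>. m21 (adj2 \<gamma> ** y ** A) = 0}"

definition left_stable :: "real ^ 2 ^ 2 \<Rightarrow> (real ^ 2 ^ 2) set" where
  "left_stable A = {y \<in> \<Delta>. \<exists>\<gamma>\<in>\<Gamma>. m21 (adj2 \<gamma> ** y ** A) = 0 \<and> \<gamma> ** shift 1 ** adj2 \<gamma> ** y \<in> Eichler_order N}"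

text \<open>Replacing (\<gamma>, y) by (B \<gamma>, B y) preserves the conditions in
  \<open>polar\<close> and \<open>left_stable\<close>; hence both sets are saturated.\<close>

lemma left_mult_pole:
  fixes A X y \<gamma> :: "real ^ 2 ^ 2"
  assumes "B \<in> Gamma0 N"
  shows "adj2 (B ** \<gamma>) ** (B ** y) ** A = adj2 \<gamma> ** y ** A"
    "(B ** \<gamma>) ** X ** adj2 (B ** \<gamma>) ** (B ** y) = B ** (\<gamma> ** X ** adj2 \<gamma> ** y)"
  using adj2_cancel(2)[OF Gamma0_det[OF assms]]
  by (simp_all add: adj2_mult matrix_mul_assoc[symmetric])

lemma saturated_polar: "saturated (polar A)"
  unfolding saturated_def
proof (intro conjI ballI)
  fix B x assume B: "B \<in> Gamma0 N" and "x \<in> polar A"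
  then obtain \<gamma> where "x \<in> \<Delta>" "\<gamma> \<in> \<Gamma>" "m21 (adj2 \<gamma> ** x ** A) = 0"
    unfolding polar_def by blast
  moreover from this have "B ** \<gamma> \<in> \<Gamma>" using B Gamma0_in_\<Gamma> \<Gamma>_mult by blast
  ultimately show "B ** x \<in> polar A"
    unfolding polar_def using \<Delta>_mult[OF B] left_mult_pole(1)[OF B, of \<gamma> x A]
    by (auto intro!: bexI[of _ "B ** \<gamma>"])
qed (auto simp: polar_def)

lemma saturated_left_stable: "saturated (left_stable A)"
  unfolding saturated_def
proof (intro conjI ballI)
  fix B x assume B: "B \<in> Gamma0 N" and "x \<in> left_stable A"
  then obtain \<gamma> where "x \<in> \<Delta>" "\<gamma> \<in> \<Gamma>" "m21 (adj2 \<gamma> ** x ** A) = 0"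
    "\<gamma> ** shift 1 ** adj2 \<gamma> ** x \<in> Eichler_order N"
    unfolding left_stable_def by blast
  moreover from this have "B ** \<gamma> \<in> \<Gamma>" using B Gamma0_in_\<Gamma> \<Gamma>_mult by blast
  moreover have "B \<in> Eichler_order N" using B by (simp add: Gamma0_eq)
  ultimately show "B ** x \<in> left_stable A"
    unfolding left_stable_def
    using \<Delta>_mult[OF B] left_mult_pole(1)[OF B, of \<gamma> x A]
      left_mult_pole(2)[OF B, of \<gamma> "shift 1" x] Eichler_order_mult
    by (auto intro!: bexI[of _ "B ** \<gamma>"])
qed (auto simp: left_stable_def)

text \<open>For a representative y, write y A = B t with B in SL2(Z) and t upper triangular. The
  cusp B\<infinity> = y A\<infinity> is not in the orbit of infinity, so F(B \<tau>) is bounded, and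
  substituting t \<tau> for \<tau> keeps it so.\<close>

lemma sum_not_polar_bounded:
  assumes A: "A \<in> Gamma0 1"
  shows "(\<lambda>\<tau>. \<Sum>C\<in>coset ` (\<Delta> - polar A). F (mobius (rep C) (mobius A \<tau>))) \<in> O[at_ioo](\<lambda>_. 1)"
proof (rule big_sum_in_bigo)
  fix C assume "C \<in> coset ` (\<Delta> - polar A)"
  then have y: "rep C \<in> \<Delta> - polar A"
    by (rule rep_in_saturated[OF saturated_Diff[OF saturated_\<Delta> saturated_polar]])
  define X where "X = rep C ** A"
  have det: "det X > 0" "det (rep C) > 0" "det A > 0"
    using y \<Delta>_det Gamma0_det[OF A] by (auto simp: X_def det_mul)
  have "X \<in> Eichler_order 1"
    unfolding X_def using y A Eichler_order_subset_1
    by (intro Eichler_order_mult) (auto simp: \<Delta>_def Gamma0_eq)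
  then obtain B where B: "B \<in> Gamma0 1" and t: "m21 (adj2 B ** X) = 0"
    using SL2Z_upper_triangular det(1) by blast
  have det_B: "det B = 1" using B by (rule Gamma0_det)
  have det_t: "det (adj2 B ** X) > 0" using det by (simp add: det_mul det_B)
  have "m21 (adj2 \<gamma> ** B) \<noteq> 0" if "\<gamma> \<in> \<Gamma>" for \<gamma>
  proof
    assume "m21 (adj2 \<gamma> ** B) = 0"
    then have "m21 ((adj2 \<gamma> ** B) ** (adj2 B ** X)) = 0"
      using t by (rule m21_mult_upper_triangular)
    also have "(adj2 \<gamma> ** B) ** (adj2 B ** X) = adj2 \<gamma> ** rep C ** A"
      using adj2_cancel(1)[OF det_B] by (simp add: X_def matrix_mul_assoc[symmetric])
    finally show False using y that by (auto simp: polar_def)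
  qed
  then have "mobius_ext B None \<notin> orbit_of \<Gamma> None"
    using infinity_orbit_iff[OF det_B] by blast
  from at_ioo_compose_upper_triangular[OF F_cusp[OF B this] t det_t]
  have "(\<lambda>\<tau>. F (mobius B (mobius (adj2 B ** X) \<tau>))) \<in> O[at_ioo](\<lambda>_. 1)" .
  moreover have "eventually (\<lambda>\<tau>. F (mobius B (mobius (adj2 B ** X) \<tau>)) = F (mobius (rep C) (mobius A \<tau>))) at_ioo"
    using eventually_upper_half_plane
  proof eventually_elim
    case (elim \<tau>)
    have "mobius B (mobius (adj2 B ** X) \<tau>) = mobius X \<tau>"
      using mobius_mult[of B "adj2 B ** X" \<tau>] det_B det_t elim adj2_cancel(1)[OF det_B] by simp
    then show ?case using mobius_mult[of "rep C" A \<tau>] det elim by (simp add: X_def)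
  qed
  ultimately show "(\<lambda>\<tau>. F (mobius (rep C) (mobius A \<tau>))) \<in> O[at_ioo](\<lambda>_. 1)"
    by (subst (asm) landau_o.big.in_cong)
qed

text \<open>The stabilizer consists of translations up to sign. Hence the conjugate of a shift by
  \<gamma> depends only on the cusp \<gamma>\<infinity>.\<close>

lemma stabilizer_commutes_shift:
  assumes "\<gamma> \<in> \<Gamma>" "m21 \<gamma> = 0"
  shows "\<gamma> ** shift i = shift i ** \<gamma>"
proof -
  obtain k :: int where "\<gamma> = mat2 1 (of_int k) 0 1 \<or> \<gamma> = mat2 (-1) (of_int k) 0 (-1)"
    using \<Gamma>_stabilizer_infinity[OF assms] by blast
  then show ?thesis by (elim disjE) (simp_all add: shift_def add.commute)
qed

text \<open>
  Averaging over the translations by \<open>i / p\<close> at each pole replaces the expansion of \<open>F\<close> by its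
  part with exponents divisible by \<open>p\<close>, which has no negative exponents.
\<close>

lemma sum_left_stable_bounded:
  assumes A: "A \<in> Gamma0 1"
  shows "(\<lambda>\<tau>. \<Sum>C\<in>coset ` left_stable A. F (mobius (rep C) (mobius A \<tau>))) \<in> O[at_ioo](\<lambda>_. 1)"
proof -
  have det_A: "det A = 1" using A by (rule Gamma0_det)
  define \<gamma> where "\<gamma> y = (SOME \<gamma>. \<gamma> \<in> \<Gamma> \<and> m21 (adj2 \<gamma> ** y ** A) = 0 \<and>
    \<gamma> ** shift 1 ** adj2 \<gamma> ** y \<in> Eichler_order N)" for y
  have \<gamma>: "\<gamma> y \<in> \<Gamma>" "m21 (adj2 (\<gamma> y) ** y ** A) = 0"
    "\<gamma> y ** shift 1 ** adj2 (\<gamma> y) ** y \<in> Eichler_order N" "y \<in> \<Delta>" if "y \<in> left_stable A" for y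
    using that someI_ex[of "\<lambda>\<gamma>. \<gamma> \<in> \<Gamma> \<and> m21 (adj2 \<gamma> ** y ** A) = 0 \<and>
      \<gamma> ** shift 1 ** adj2 \<gamma> ** y \<in> Eichler_order N"]
    unfolding left_stable_def \<gamma>_def by blast+
  \<comment> \<open>Here y A = \<gamma> t with \<open>t y\<close> upper triangular, and
    \<open>\<psi> i y\<close> inserts the translation by i / p between \<gamma> and t.\<close>
  define t where "t y = adj2 (\<gamma> y) ** y ** A" for y
  define \<psi> where "\<psi> i y = \<gamma> y ** shift i ** adj2 (\<gamma> y) ** y" for i y
  have det_\<gamma>: "det (\<gamma> y) = 1" if "y \<in> left_stable A" for y
    using \<gamma>(1)[OF that] by (rule \<Gamma>_det)
  have det_t: "det (t y) > 0" if "y \<in> left_stable A" for y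
    using \<Delta>_det[OF \<gamma>(4)[OF that]] by (simp add: t_def det_mul det_\<gamma>[OF that] det_A)
  have \<psi>_A: "\<psi> i y ** A = \<gamma> y ** (shift i ** t y)" for i y
    by (simp add: \<psi>_def t_def matrix_mul_assoc)
  \<comment> \<open>Conjugation by \<open>\<gamma> y\<close>, which normalizes the order, moves the
    pole to infinity, where \<open>shift_mult_in_order\<close> applies.\<close>
  have \<psi>_\<Delta>: "\<psi> i y \<in> \<Delta>" if y: "y \<in> left_stable A" for i y
  proof -
    have n: "normalizes (\<gamma> y) N" using \<gamma>(1)[OF y] by (rule \<Gamma>_normalizes)
    have conj: "adj2 (\<gamma> y) ** \<psi> i y ** \<gamma> y = shift i ** (adj2 (\<gamma> y) ** y ** \<gamma> y)" for i
      using adj2_cancel(2)[OF det_\<gamma>[OF y]] by (simp add: \<psi>_def matrix_mul_assoc[symmetric])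
    have "adj2 (\<gamma> y) ** y ** \<gamma> y \<in> Eichler_order N"
      using n \<gamma>(4)[OF y] by (simp add: normalizes_def \<Delta>_def)
    moreover have "shift 1 ** (adj2 (\<gamma> y) ** y ** \<gamma> y) \<in> Eichler_order N"
      using n \<gamma>(3)[OF y] unfolding conj[symmetric] by (simp add: normalizes_def \<psi>_def)
    ultimately have "shift i ** (adj2 (\<gamma> y) ** y ** \<gamma> y) \<in> Eichler_order N"
      by (rule shift_mult_in_order)
    then have "\<gamma> y ** (adj2 (\<gamma> y) ** \<psi> i y ** \<gamma> y) ** adj2 (\<gamma> y) \<in> Eichler_order N"
      using n unfolding conj[symmetric] by (simp add: normalizes_def)
    also have "\<gamma> y ** (adj2 (\<gamma> y) ** \<psi> i y ** \<gamma> y) ** adj2 (\<gamma> y) = \<psi> i y"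
      using adj2_cancel(1)[OF det_\<gamma>[OF y]] mult_adj2(1)[OF det_\<gamma>[OF y]]
      by (simp add: matrix_mul_assoc[symmetric])
    finally show ?thesis
      using \<gamma>(4)[OF y] by (simp add: \<Delta>_def \<psi>_def det_mul det_\<gamma>[OF y])
  qed
  have \<psi>_in: "\<psi> i y \<in> left_stable A" if y: "y \<in> left_stable A" for i y
  proof -
    have "adj2 (\<gamma> y) ** \<psi> i y = shift i ** adj2 (\<gamma> y) ** y"
      using adj2_cancel(2)[OF det_\<gamma>[OF y]] by (simp add: \<psi>_def matrix_mul_assoc[symmetric])
    then have 1: "adj2 (\<gamma> y) ** \<psi> i y ** A = shift i ** t y"
      and 2: "\<gamma> y ** shift 1 ** adj2 (\<gamma> y) ** \<psi> i y = \<psi> (1 + i) y"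
      by (simp_all add: t_def \<psi>_def matrix_mul_assoc[symmetric]) (simp add: matrix_mul_assoc shift_mult_shift)
    have "m21 (adj2 (\<gamma> y) ** \<psi> i y ** A) = 0"
      using \<gamma>(2)[OF y] unfolding 1 t_def[symmetric] by (intro m21_mult_upper_triangular) (simp_all add: shift_def)
    moreover have "\<gamma> y ** shift 1 ** adj2 (\<gamma> y) ** \<psi> i y \<in> Eichler_order N"
      using \<psi>_\<Delta>[OF y, of "1 + i"] unfolding 2 by (simp add: \<Delta>_def)
    ultimately show ?thesis
      using \<psi>_\<Delta>[OF y] \<gamma>(1)[OF y] unfolding left_stable_def by blast
  qed
  have inj: "coset x = coset y"
    if x: "x \<in> left_stable A" and y: "y \<in> left_stable A" and xy: "coset (\<psi> i x) = coset (\<psi> i y)" for i x y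
  proof -
    obtain B where B: "B \<in> Gamma0 N" "\<psi> i x = B ** \<psi> i y"
      using coset_eqD xy by blast
    \<comment> \<open>\<open>\<kappa>\<close> compares the elements chosen for \<open>x\<close> and
      \<open>y\<close>. By \<open>eq\<close> it turns out to fix infinity, so it commutes with the
      shift, which can then be cancelled.\<close>
    define \<kappa> where "\<kappa> = adj2 (\<gamma> x) ** B ** \<gamma> y"
    have \<kappa>: "\<kappa> \<in> \<Gamma>"
      unfolding \<kappa>_def
      by (rule \<Gamma>_mult[OF \<Gamma>_mult[OF \<Gamma>_adj2[OF \<gamma>(1)[OF x]] Gamma0_in_\<Gamma>[OF B(1)]] \<gamma>(1)[OF y]])
    have "\<gamma> x ** (shift i ** t x) = B ** (\<gamma> y ** (shift i ** t y))"
      using B(2) \<psi>_A by (metis matrix_mul_assoc)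
    then have eq: "shift i ** t x = \<kappa> ** (shift i ** t y)"
      using adj2_cancel(2)[OF det_\<gamma>[OF x]] unfolding \<kappa>_def by (metis matrix_mul_assoc)
    have tx: "m21 (t x) = 0" and ty: "m21 (t y) = 0"
      using \<gamma>(2) x y by (simp_all add: t_def)
    have "m21 (\<kappa> ** (shift i ** t y)) = 0"
      unfolding eq[symmetric] using tx by (intro m21_mult_upper_triangular) (simp_all add: shift_def)
    moreover have "m21 (shift i ** t y) = 0"
      using ty by (intro m21_mult_upper_triangular) (simp_all add: shift_def)
    moreover have "det (shift i ** t y) > 0" using det_t[OF y] by (simp add: det_mul)
    ultimately have "m21 \<kappa> = 0"
      by (auto simp: mat2_mult_nth[of \<kappa>] det_2)
    then have "shift i ** t x = shift i ** (\<kappa> ** t y)"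
      using eq stabilizer_commutes_shift[OF \<kappa>] by (simp add: matrix_mul_assoc)
    then have "t x = \<kappa> ** t y"
      using adj2_cancel(2)[OF det_shift] by metis
    then have "\<gamma> x ** t x = \<gamma> x ** \<kappa> ** t y" by (simp add: matrix_mul_assoc)
    then have "x ** A = (B ** y) ** A"
      using adj2_cancel(1)[OF det_\<gamma>[OF x]] adj2_cancel(1)[OF det_\<gamma>[OF y]]
      by (simp add: t_def \<kappa>_def matrix_mul_assoc[symmetric])
    then have "x = B ** y" by (rule mult_left_cancel_det) (simp add: det_A)
    then show ?thesis using B(1) coset_mult by simp
  qed
  define G where "G = (\<lambda>\<tau>. \<Sum>C\<in>coset ` left_stable A. F (mobius (rep C) (mobius A \<tau>)))"
  define T where "T = (\<lambda>\<tau>. \<Sum>i<p. F (\<tau> + of_real (real i / real p)))"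
  have rep: "rep C \<in> left_stable A" if "C \<in> coset ` left_stable A" for C
    using rep_in_saturated[OF saturated_left_stable that] .
  \<comment> \<open>Each of the \<open>p\<close> permutations leaves \<open>G\<close> unchanged;
    summing over \<open>i\<close> collects the translates at each class into the trace
    \<open>T\<close>.\<close>
  have avg: "of_nat p * G \<tau> = (\<Sum>C\<in>coset ` left_stable A. T (mobius (t (rep C)) \<tau>))"
    if \<tau>: "\<tau> \<in> upper_half_plane" for \<tau>
  proof -
    have A\<tau>: "mobius A \<tau> \<in> upper_half_plane"
      using \<tau> det_A by (simp add: mobius_in_upper_half_plane)
    have shifted: "F (mobius (\<psi> i y) (mobius A \<tau>)) = F (mobius (t y) \<tau> + of_real (real i / real p))"
      if y: "y \<in> left_stable A" for i y
    proof -
      have "mobius (\<psi> i y) (mobius A \<tau>) = mobius (\<gamma> y ** (shift i ** t y)) \<tau>"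
        using \<Delta>_det[OF \<psi>_\<Delta>[OF y]] det_A \<tau> by (simp add: mobius_mult flip: \<psi>_A)
      also have "\<dots> = mobius (\<gamma> y) (mobius (shift i ** t y) \<tau>)"
        using det_t[OF y] det_\<gamma>[OF y] \<tau> by (intro mobius_mult) (simp_all add: det_mul)
      also have "F \<dots> = F (mobius (shift i ** t y) \<tau>)"
        using det_t[OF y] \<tau> by (intro F_inv \<gamma>(1)[OF y] mobius_in_upper_half_plane) (simp_all add: det_mul)
      also have "mobius (shift i ** t y) \<tau> = mobius (t y) \<tau> + of_real (real i / real p)"
        using det_t[OF y] \<tau> mobius_shift by (simp add: mobius_mult)
      finally show ?thesis .
    qed
    have "G \<tau> = (\<Sum>C\<in>coset ` left_stable A. F (mobius (t (rep C)) \<tau> + of_real (real i / real p)))" for i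
    proof -
      have "(\<Sum>C\<in>coset ` left_stable A. F (mobius (\<psi> i (rep C)) (mobius A \<tau>))) = G \<tau>"
        unfolding G_def
      proof (rule sum_cosets_permute[where h = "\<lambda>y. F (mobius y (mobius A \<tau>))" and \<psi> = "\<psi> i"])
        fix B y assume "B \<in> Gamma0 N" "y \<in> left_stable A"
        then show "F (mobius (B ** y) (mobius A \<tau>)) = F (mobius y (mobius A \<tau>))"
          using F_Gamma0 A\<tau> \<Delta>_det \<gamma>(4) by blast
      qed (use saturated_left_stable \<psi>_in inj in blast)+
      then show ?thesis
        using shifted[OF rep] by simp
    qed
    then have "(\<Sum>i<p. G \<tau>) = (\<Sum>i<p. \<Sum>C\<in>coset ` left_stable A. F (mobius (t (rep C)) \<tau> + of_real (real i / real p)))"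
      by (intro sum.cong refl)
    also have "\<dots> = (\<Sum>C\<in>coset ` left_stable A. T (mobius (t (rep C)) \<tau>))"
      unfolding T_def by (rule sum.swap)
    finally show ?thesis by simp
  qed
  have "(\<lambda>\<tau>. \<Sum>C\<in>coset ` left_stable A. T (mobius (t (rep C)) \<tau>)) \<in> O[at_ioo](\<lambda>_. 1)"
  proof (rule big_sum_in_bigo)
    fix C assume "C \<in> coset ` left_stable A"
    from rep[OF this] show "(\<lambda>\<tau>. T (mobius (t (rep C)) \<tau>)) \<in> O[at_ioo](\<lambda>_. 1)"
      using \<gamma>(2) det_t F_trace unfolding T_def
      by (intro at_ioo_compose_upper_triangular) (simp_all add: t_def)
  qed
  moreover have "eventually (\<lambda>\<tau>. (\<Sum>C\<in>coset ` left_stable A. T (mobius (t (rep C)) \<tau>)) = of_nat p * G \<tau>) at_ioo"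
    using eventually_upper_half_plane by eventually_elim (simp add: avg)
  ultimately have "(\<lambda>\<tau>. of_nat p * G \<tau>) \<in> O[at_ioo](\<lambda>_. 1)"
    by (subst (asm) landau_o.big.in_cong)
  then have "G \<in> O[at_ioo](\<lambda>_. 1)" using p_pos by simp
  then show ?thesis by (simp only: G_def)
qed

text \<open>If left stability fails, then \<open>p\<close> does not divide both entries of the
  bottom row, which is therefore primitive and completes to the inverse of an element of
  \<open>Gamma0 N\<close>.\<close>

lemma not_left_stable_row:
  assumes z: "z \<in> \<Delta>" "shift 1 ** z \<notin> Eichler_order N"
  obtains B where "B \<in> Gamma0 N" "m21 (adj2 B) = m21 z" "m22 (adj2 B) = m22 z"
proof -
  obtain a b c d where z_eq: "z = mat2 (of_int a) (of_int b) (of_int (int N * c)) (of_int d)"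
    using z(1) by (auto simp: \<Delta>_def elim: Eichler_orderE)
  have "real_of_int (d * a - b * (int N * c)) = of_int (int (p ^ r))"
    using z(1) by (simp add: \<Delta>_def z_eq algebra_simps)
  then have "d * a - b * (int N * c) = int p ^ r"
    by (simp only: of_int_eq_iff of_nat_power)
  moreover have "\<not> (int p dvd d \<and> int p dvd int N * c)"
  proof
    assume "int p dvd d \<and> int p dvd int N * c"
    then obtain d' c' where "d = int p * d'" "int N * c = int p * c'" by (auto elim!: dvdE)
    then have d': "real_of_int d = real p * of_int d'" and c': "real N * real_of_int c = real p * of_int c'"
      by (metis of_int_mult of_int_of_nat_eq)+
    have "shift 1 ** z \<in> Eichler_order N"
      using p_pos d' c' by (intro Eichler_orderI[of _ "a + c'" "b + d'" _ c d]) (simp_all add: z_eq shift_def)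
    with z(2) show False by simp
  qed
  ultimately have "coprime d (int N * c)"
    by (rule coprime_if_dvd_prime_power[OF p])
  then obtain u v where uv: "u * d + v * (int N * c) = 1"
    by (metis bezout_int coprime_iff_gcd_eq_1)
  define B where "B = mat2 (of_int d) (of_int v) (of_int (int N * (- c))) (of_int u)"
  have "real_of_int (u * d + v * (int N * c)) = 1" unfolding uv by simp
  then have "det B = 1" by (simp add: B_def algebra_simps)
  moreover have "B \<in> Eichler_order N" unfolding B_def by (rule Eichler_orderI) (rule mat2_nth)+
  ultimately have "B \<in> Gamma0 N" by (simp add: Gamma0_eq)
  then show thesis by (rule that) (simp_all add: B_def z_eq)
qed

text \<open>Since z = \<gamma>^-1 y \<gamma> and B^-1 share their bottom row, B^-1 \<gamma>^-1 A has
  the lower left entry of z \<gamma>^-1 A = \<gamma>^-1 y A, which is 0. Thus unstable polar classes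
  occur only at cusps equivalent to infinity.\<close>

lemma not_left_stable:
  assumes \<gamma>: "\<gamma> \<in> \<Gamma>" "m21 (adj2 \<gamma> ** y ** A) = 0" and y: "y \<in> \<Delta>"
    and not_stable: "\<gamma> ** shift 1 ** adj2 \<gamma> ** y \<notin> Eichler_order N"
  obtains B where "B \<in> Gamma0 N" "m21 (adj2 (\<gamma> ** B) ** A) = 0"
proof -
  have n: "normalizes \<gamma> N" and det: "det \<gamma> = 1"
    using \<gamma>(1) \<Gamma>_normalizes \<Gamma>_det by blast+
  define z where "z = adj2 \<gamma> ** y ** \<gamma>"
  have z: "z \<in> \<Delta>"
    using n y by (simp add: normalizes_def \<Delta>_def z_def det_mul)
  have "shift 1 ** z \<notin> Eichler_order N"
  proof
    assume "shift 1 ** z \<in> Eichler_order N"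
    then have "\<gamma> ** (shift 1 ** z) ** adj2 \<gamma> \<in> Eichler_order N"
      using n by (simp add: normalizes_def)
    also have "\<gamma> ** (shift 1 ** z) ** adj2 \<gamma> = \<gamma> ** shift 1 ** adj2 \<gamma> ** y"
      using mult_adj2(1)[OF det] by (simp add: z_def matrix_mul_assoc[symmetric])
    finally show False using not_stable by simp
  qed
  then obtain B where B: "B \<in> Gamma0 N" "m21 (adj2 B) = m21 z" "m22 (adj2 B) = m22 z"
    using not_left_stable_row z by blast
  have "m21 (adj2 (\<gamma> ** B) ** A) = m21 (adj2 B ** (adj2 \<gamma> ** A))"
    by (simp add: adj2_mult matrix_mul_assoc)
  also have "\<dots> = m21 (z ** (adj2 \<gamma> ** A))"
    unfolding mat2_mult_nth(3)[of "adj2 B"] mat2_mult_nth(3)[of z] B ..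
  also have "z ** (adj2 \<gamma> ** A) = adj2 \<gamma> ** y ** A"
    using adj2_cancel(1)[OF det] by (simp add: z_def matrix_mul_assoc[symmetric])
  finally show thesis using B(1) \<gamma>(2) that by simp
qed

text \<open>Classes that avoid the poles and left-stable classes contribute bounded terms, so only
  the remaining polar classes can produce a pole.\<close>

lemma hecke_sum_cusp:
  assumes A: "A \<in> Gamma0 1"
  shows "(\<lambda>\<tau>. hecke_sum (mobius A \<tau>) -
      (\<Sum>C\<in>coset ` (polar A - left_stable A). F (mobius (rep C) (mobius A \<tau>)))) \<in> O[at_ioo](\<lambda>_. 1)"
proof -
  have "polar A \<subseteq> \<Delta>" "left_stable A \<subseteq> polar A"
    by (auto simp: polar_def left_stable_def)
  then have "hecke_sum (mobius A \<tau>) - (\<Sum>C\<in>coset ` (polar A - left_stable A). F (mobius (rep C) (mobius A \<tau>))) =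
     (\<Sum>C\<in>coset ` left_stable A. F (mobius (rep C) (mobius A \<tau>))) +
     (\<Sum>C\<in>coset ` (\<Delta> - polar A). F (mobius (rep C) (mobius A \<tau>)))" for \<tau>
    using sum_cosets_split[OF saturated_\<Delta> saturated_polar[of A], of "\<lambda>y. F (mobius y (mobius A \<tau>))"]
      sum_cosets_split[OF saturated_polar saturated_left_stable[of A], of A "\<lambda>y. F (mobius y (mobius A \<tau>))"]
    by (simp add: hecke_sum_def)
  then show ?thesis
    using sum_in_bigo(1)[OF sum_left_stable_bounded[OF A] sum_not_polar_bounded[OF A]] by simp
qed

lemma hecke_sum_bounded:
  assumes A: "A \<in> Gamma0 1" "mobius_ext A None \<notin> orbit_of \<Gamma> None"
  shows "(\<lambda>\<tau>. hecke_sum (mobius A \<tau>)) \<in> O[at_ioo](\<lambda>_. 1)"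
proof -
  have "y \<in> left_stable A" if "y \<in> polar A" for y
  proof (rule ccontr)
    assume "y \<notin> left_stable A"
    then obtain \<gamma> where \<gamma>: "y \<in> \<Delta>" "\<gamma> \<in> \<Gamma>" "m21 (adj2 \<gamma> ** y ** A) = 0"
      "\<gamma> ** shift 1 ** adj2 \<gamma> ** y \<notin> Eichler_order N"
      using \<open>y \<in> polar A\<close> by (auto simp: polar_def left_stable_def)
    then obtain B where "B \<in> Gamma0 N" "m21 (adj2 (\<gamma> ** B) ** A) = 0"
      using not_left_stable by blast
    then show False
      using A infinity_orbit_iff[OF Gamma0_det[OF A(1)]] \<Gamma>_mult[OF \<gamma>(2) Gamma0_in_\<Gamma>] by blast
  qed
  then have empty: "polar A - left_stable A = {}" by blast
  show ?thesis using hecke_sum_cusp[OF A(1)] unfolding empty by simp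
qed

text \<open>At infinity, \<open>not_left_stable\<close> yields \<open>B\<close> with \<gamma> B
  fixing infinity, so \<gamma> is in \<open>Gamma0 N\<close> and y is equivalent to an upper
  triangular t. Instability forces the lower right entry of t to be \<pm>1, which leaves the class
  of diag(p^r, 1).\<close>

lemma cosets_polar_infinity:
  "coset ` (polar (mat 1) - left_stable (mat 1)) = {coset (mat2 (real (p ^ r)) 0 0 1)}"
proof -
  define T where "T = mat2 (real (p ^ r)) 0 0 1"
  have P: "real (p ^ r) > 0" using p_pos by simp
  have T: "T \<in> \<Delta>"
    unfolding \<Delta>_def T_def by (auto intro: Eichler_orderI[of _ "int (p ^ r)" 0 _ 0 1])
  have shift_T: "shift 1 ** T \<notin> Eichler_order N"
  proof
    assume "shift 1 ** T \<in> Eichler_order N"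
    then obtain k :: int where "1 / real p = of_int k"
      by (auto elim!: Eichler_orderE simp: shift_def T_def mat2_eq_iff)
    then have "1 = real_of_int (k * int p)"
      using p_pos by (simp add: field_simps)
    then have "k * int p = 1" by (simp only: of_int_eq_1_iff)
    then have "int p dvd 1" by (metis dvd_triv_right)
    then show False using p prime_gt_1_nat[of p] by simp
  qed
  have "T \<in> polar (mat 1)"
    using T Gamma0_in_\<Gamma>[OF Gamma0_one] unfolding polar_def
    by (auto intro!: bexI[of _ "mat 1"] simp: mat_1_eq_mat2 T_def)
  moreover have "T \<notin> left_stable (mat 1)"
  proof
    assume "T \<in> left_stable (mat 1)"
    then obtain \<gamma> where \<gamma>: "\<gamma> \<in> \<Gamma>" "m21 (adj2 \<gamma> ** T) = 0" "\<gamma> ** shift 1 ** adj2 \<gamma> ** T \<in> Eichler_order N"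
      unfolding left_stable_def by auto
    have "m21 \<gamma> = 0"
      using \<gamma>(2) p_pos by (simp add: mat2_mult_nth T_def adj2_def)
    then have "\<gamma> ** shift 1 ** adj2 \<gamma> ** T = shift 1 ** T"
      using stabilizer_commutes_shift[OF \<gamma>(1)] adj2_cancel(1)[OF \<Gamma>_det[OF \<gamma>(1)]]
      by (simp add: matrix_mul_assoc[symmetric])
    then show False using \<gamma>(3) shift_T by simp
  qed
  ultimately have T_in: "T \<in> polar (mat 1) - left_stable (mat 1)" by blast
  have "coset y = coset T" if y_in: "y \<in> polar (mat 1) - left_stable (mat 1)" for y
  proof -
    obtain \<gamma> where \<gamma>: "\<gamma> \<in> \<Gamma>" "m21 (adj2 \<gamma> ** y) = 0" and y: "y \<in> \<Delta>"
      and not_stable: "\<gamma> ** shift 1 ** adj2 \<gamma> ** y \<notin> Eichler_order N"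
      using y_in unfolding polar_def left_stable_def matrix_mul_rid by blast
    then obtain B where B: "B \<in> Gamma0 N" "m21 (adj2 (\<gamma> ** B)) = 0"
      using not_left_stable[OF \<gamma>(1) _ y not_stable, of "mat 1"] by auto
    have "\<gamma> ** B \<in> Gamma0 N"
      using B \<gamma>(1) \<Gamma>_mult Gamma0_in_\<Gamma> by (intro \<Gamma>_stabilizer_subset_Gamma0) (auto simp: adj2_def)
    then have "(\<gamma> ** B) ** adj2 B \<in> Gamma0 N"
      by (rule Gamma0_mult) (rule Gamma0_adj2[OF B(1)])
    then have \<gamma>0: "\<gamma> \<in> Gamma0 N"
      using mult_adj2(1)[OF Gamma0_det[OF B(1)]] by (simp add: matrix_mul_assoc[symmetric])
    define t where "t = adj2 \<gamma> ** y"
    have t: "t \<in> \<Delta>" "m21 t = 0" "coset t = coset y"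
      unfolding t_def using \<gamma>0 y \<gamma>(2) Gamma0_adj2 \<Delta>_mult coset_mult by auto
    have shift_t: "shift 1 ** t \<notin> Eichler_order N"
      using not_stable \<gamma>0 Eichler_order_mult[of \<gamma> N "shift 1 ** t"]
      by (auto simp: t_def Gamma0_eq matrix_mul_assoc)
    obtain a b c d where "t = mat2 (of_int a) (of_int b) (of_int (int N * c)) (of_int d)"
      using t(1) by (auto simp: \<Delta>_def elim: Eichler_orderE)
    then have t_eq: "t = mat2 (of_int a) (of_int b) 0 (of_int d)" using t(2) by auto
    have "real_of_int (a * d) = of_int (int (p ^ r))"
      using t(1) by (simp add: \<Delta>_def t_eq)
    then have ad: "a * d = int p ^ r" by (simp only: of_int_eq_iff of_nat_power)
    have "\<not> int p dvd d"
    proof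
      assume "int p dvd d"
      then obtain d' where "d = int p * d'" by (rule dvdE)
      then have "shift 1 ** t \<in> Eichler_order N"
        using p_pos by (intro Eichler_orderI[of _ a "b + d'" _ 0 d]) (simp_all add: t_eq shift_def)
      with shift_t show False by simp
    qed
    \<comment> \<open>The bottom row is (0, d); its coprimality means that \<open>d\<close> is a
      unit.\<close>
    moreover have "d * a - 0 * 0 = int p ^ r" using ad by (simp add: mult.commute)
    ultimately have "coprime d 0"
      using coprime_if_dvd_prime_power[OF p, of d a 0 0 r] by blast
    then have "\<bar>d\<bar> = 1" by simp
    then have "d = 1 \<or> d = - 1" by arith
    then have dd: "d * d = 1" by auto
    have "d * int p ^ r = a * (d * d)" unfolding ad[symmetric] by simp
    then have a: "real_of_int a = of_int d * real (p ^ r)"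
      unfolding dd by (metis mult_1_right of_int_mult of_int_of_nat_eq of_nat_power)
    \<comment> \<open>Up to the sign \<open>d\<close>, this is the translation that absorbs the
      upper right entry of \<open>t\<close>.\<close>
    define E where "E = mat2 (of_int d) (of_int b) 0 (of_int d)"
    have "real_of_int (d * d) = 1" unfolding dd by simp
    then have "E \<in> Gamma0 N"
      unfolding E_def Gamma0_eq by (auto intro: Eichler_orderI[of _ d b _ 0 d])
    moreover have "t = E ** T" by (simp add: t_eq E_def T_def a)
    ultimately show ?thesis using t(3) coset_mult by metis
  qed
  then have "coset ` (polar (mat 1) - left_stable (mat 1)) = (\<lambda>_. coset T) ` (polar (mat 1) - left_stable (mat 1))"
    by (intro image_cong refl)
  also have "\<dots> = {coset T}" using T_in by (rule image_constant)
  finally show ?thesis by (simp only: T_def)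
qed

lemma hecke_sum_infinity:
  "(\<lambda>\<tau>. hecke_sum \<tau> - F (of_nat (p ^ r) * \<tau>)) \<in> O[at_ioo](\<lambda>_. 1)"
proof -
  have T: "mat2 (real (p ^ r)) 0 0 1 \<in> \<Delta>"
    unfolding \<Delta>_def by (auto intro: Eichler_orderI[of _ "int (p ^ r)" 0 _ 0 1])
  have "(\<lambda>\<tau>. hecke_sum \<tau> - F (mobius (rep (coset (mat2 (real (p ^ r)) 0 0 1))) \<tau>)) \<in> O[at_ioo](\<lambda>_. 1)"
    using hecke_sum_cusp[OF Gamma0_one] by (simp add: cosets_polar_infinity del: of_nat_power)
  moreover have "F (mobius (rep (coset (mat2 (real (p ^ r)) 0 0 1))) \<tau>) = F (of_nat (p ^ r) * \<tau>)"
    if "\<tau> \<in> upper_half_plane" for \<tau>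
    unfolding F_rep_coset[OF T that] by (simp add: mobius_def)
  then have "eventually (\<lambda>\<tau>. hecke_sum \<tau> - F (mobius (rep (coset (mat2 (real (p ^ r)) 0 0 1))) \<tau>) =
      hecke_sum \<tau> - F (of_nat (p ^ r) * \<tau>)) at_ioo"
    by (intro eventually_mono[OF eventually_upper_half_plane]) (simp only:)
  ultimately show ?thesis
    by (subst (asm) landau_o.big.in_cong)
qed

end

section \<open>The congruence\<close>

context level
begin

lemma translation_invariant:
  assumes "\<And>A \<tau>. A \<in> \<Gamma> \<Longrightarrow> \<tau> \<in> upper_half_plane \<Longrightarrow> f (mobius A \<tau>) = f \<tau>"
    and "\<tau> \<in> upper_half_plane"
  shows "f (\<tau> + of_int k) = f \<tau>"
  using assms(1)[OF Gamma0_in_\<Gamma>[OF Gamma0_translation[of k]] assms(2)] by (simp add: mobius_def)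

text \<open>Boundedness is the form of the condition that passes through sums and matrix
  substitutions. Conversely, the conjugate by \<open>A\<close> of the translation by
  \<open>N\<close> lies in \<open>Gamma0 N\<close>, so f(A \<tau>) has period \<open>N\<close> and
  the singularity in the nome of \<tau> / N is removable.\<close>

lemma holomorphic_at_cusp_iff:
  assumes hol: "f holomorphic_on upper_half_plane"
    and inv: "\<And>A \<tau>. A \<in> \<Gamma> \<Longrightarrow> \<tau> \<in> upper_half_plane \<Longrightarrow> f (mobius A \<tau>) = f \<tau>"
    and A: "A \<in> Gamma0 1"
  shows "holomorphic_at_cusp f A \<longleftrightarrow> (\<lambda>\<tau>. f (mobius A \<tau>)) \<in> O[at_ioo](\<lambda>_. 1)"
proof
  assume "holomorphic_at_cusp f A"
  then obtain h :: real and G where h: "h > 0" and G: "G analytic_on {0}"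
    and eq: "\<And>\<tau>. \<tau> \<in> upper_half_plane \<Longrightarrow> f (mobius A \<tau>) = G (exp (2 * of_real pi * \<i> * \<tau> / of_real h))"
    unfolding holomorphic_at_cusp_def by blast
  have "isCont G 0"
    using G analytic_at_imp_isCont by blast
  then have "G \<in> O[at 0](\<lambda>_. 1)"
    by (intro bigoI_tendsto[where c = "G 0"]) (auto simp: isCont_def)
  then have "(\<lambda>\<tau>. G (nome \<tau>)) \<in> O[at_ioo](\<lambda>_. 1)"
    by (rule landau_o.big.compose[OF _ filterlim_nome])
  \<comment> \<open>Division by the width \<open>h\<close> is the action of an upper triangular
    matrix.\<close>
  then have "(\<lambda>\<tau>. G (nome (mobius (mat2 1 0 0 h) \<tau>))) \<in> O[at_ioo](\<lambda>_. 1)"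
    by (rule at_ioo_compose_upper_triangular) (use h in auto)
  moreover have "mobius (mat2 1 0 0 h) \<tau> = \<tau> / of_real h" for \<tau>
    by (simp add: mobius_def)
  then have "eventually (\<lambda>\<tau>. G (nome (mobius (mat2 1 0 0 h) \<tau>)) = f (mobius A \<tau>)) at_ioo"
    by (intro eventually_mono[OF eventually_upper_half_plane]) (simp add: eq nome_def)
  ultimately show "(\<lambda>\<tau>. f (mobius A \<tau>)) \<in> O[at_ioo](\<lambda>_. 1)"
    by (subst (asm) landau_o.big.in_cong)
next
  assume bdd: "(\<lambda>\<tau>. f (mobius A \<tau>)) \<in> O[at_ioo](\<lambda>_. 1)"
  have det: "det A = 1" using A by (rule Gamma0_det)
  have hol': "(\<lambda>\<tau>. f (mobius A \<tau>)) holomorphic_on upper_half_plane"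
    using holomorphic_on_compose_gen[OF mobius_holomorphic[of A] hol] mobius_in_upper_half_plane[of A] det
    by (auto simp: o_def)
  obtain a b c d where A_eq: "A = mat2 (of_int a) (of_int b) (of_int (int 1 * c)) (of_int d)"
    using A by (auto simp: Gamma0_eq elim: Eichler_orderE)
  have ad: "of_int a * of_int d - of_int b * of_int c = (1 :: real)"
    using det by (simp add: A_eq)
  define B where "B = A ** mat2 1 (real N) 0 1 ** adj2 A"
  have B: "B \<in> Gamma0 N"
  proof -
    \<comment> \<open>With the matrix unit e12, B = 1 + N A e12 A^-1 is congruent to the identity
      modulo \<open>N\<close>.\<close>
    have "B = mat2 (of_int (1 - int N * a * c)) (of_int (int N * a * a)) (of_int (int N * (- c * c))) (of_int (1 + int N * a * c))"
      using ad unfolding B_def A_eq by (simp add: mat2_eq_iff algebra_simps)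
    then have "B \<in> Eichler_order N" by (simp only:) (rule Eichler_orderI; rule mat2_nth)
    moreover have "det B = 1" by (simp add: B_def det_mul det)
    ultimately show ?thesis by (simp add: Gamma0_eq)
  qed
  have per: "f (mobius A (\<tau> + of_real (real N))) = f (mobius A \<tau>)" if \<tau>: "\<tau> \<in> upper_half_plane" for \<tau>
  proof -
    have "mobius A (\<tau> + of_real (real N)) = mobius A (mobius (mat2 1 (real N) 0 1) \<tau>)"
      by (simp add: mobius_def)
    also have "\<dots> = mobius (A ** mat2 1 (real N) 0 1) \<tau>"
      using \<tau> det by (simp add: mobius_mult)
    also have "A ** mat2 1 (real N) 0 1 = B ** A"
      using mult_adj2(2)[OF det] by (simp add: B_def matrix_mul_assoc[symmetric])
    also have "mobius (B ** A) \<tau> = mobius B (mobius A \<tau>)"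
      using \<tau> det Gamma0_det[OF B] by (simp add: mobius_mult)
    also have "f \<dots> = f (mobius A \<tau>)"
      using \<tau> det by (intro inv Gamma0_in_\<Gamma> B mobius_in_upper_half_plane) simp_all
    finally show ?thesis .
  qed
  obtain \<Phi> where \<Phi>: "\<Phi> holomorphic_on ball 0 1"
    "\<And>\<tau>. \<tau> \<in> upper_half_plane \<Longrightarrow> f (mobius A \<tau>) = \<Phi> (nome (\<tau> / of_real (real N)))"
    using periodic_bounded_imp_function_of_nome[OF hol' _ per bdd] N by auto
  have "\<Phi> analytic_on {0}"
    using \<Phi>(1) by (auto simp: analytic_at intro!: exI[of _ "ball 0 1"])
  then show "holomorphic_at_cusp f A"
    unfolding holomorphic_at_cusp_def using \<Phi>(2) N
    by (intro exI[of _ "real N"] conjI exI[of _ \<Phi>]) (auto simp: nome_def)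
qed

lemma M0_inf_iff:
  "f \<in> M0_inf \<Gamma> \<longleftrightarrow> f holomorphic_on upper_half_plane \<and>
     (\<forall>A\<in>\<Gamma>. \<forall>\<tau>\<in>upper_half_plane. f (mobius A \<tau>) = f \<tau>) \<and>
     (\<exists>K. (\<lambda>\<tau>. f \<tau> * nome \<tau> powi K) \<in> O[at_ioo](\<lambda>_. 1)) \<and>
     (\<forall>A\<in>Gamma0 1. mobius_ext A None \<notin> orbit_of \<Gamma> None \<longrightarrow> (\<lambda>\<tau>. f (mobius A \<tau>)) \<in> O[at_ioo](\<lambda>_. 1))"
proof (cases "f holomorphic_on upper_half_plane \<and> (\<forall>A\<in>\<Gamma>. \<forall>\<tau>\<in>upper_half_plane. f (mobius A \<tau>) = f \<tau>)")
  case True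
  then have hol: "f holomorphic_on upper_half_plane"
    and inv: "\<And>A \<tau>. A \<in> \<Gamma> \<Longrightarrow> \<tau> \<in> upper_half_plane \<Longrightarrow> f (mobius A \<tau>) = f \<tau>" by auto
  have "f (\<tau> + 1) = f \<tau>" if "\<tau> \<in> upper_half_plane" for \<tau>
    using translation_invariant[of f \<tau> 1, OF inv that] by simp
  then have "(\<exists>L. has_q_expansion f L) \<longleftrightarrow> (\<exists>K. (\<lambda>\<tau>. f \<tau> * nome \<tau> powi K) \<in> O[at_ioo](\<lambda>_. 1))"
    using has_q_expansion_growth q_expansion_of_periodic[OF hol] by metis
  then show ?thesis
    unfolding M0_inf_def using True holomorphic_at_cusp_iff[OF hol inv] by auto
qed (auto simp: M0_inf_def)

lemma nome_powi_bounded: "k \<ge> 0 \<Longrightarrow> (\<lambda>\<tau>. nome \<tau> powi k) \<in> O[at_ioo](\<lambda>_. 1)"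
proof -
  assume "k \<ge> 0"
  then have "norm (nome \<tau> powi k) \<le> 1" if "Im \<tau> > 0" for \<tau>
    using norm_nome_less_1[of \<tau>] that
    by (simp add: upper_half_plane_def norm_power power_int_def power_le_one)
  then show ?thesis unfolding bigo_ioo_1_iff by blast
qed

lemma growth_mono:
  assumes "(\<lambda>\<tau>. f \<tau> * nome \<tau> powi K) \<in> O[at_ioo](\<lambda>_. 1)" "K \<le> K'"
  shows "(\<lambda>\<tau>. f \<tau> * nome \<tau> powi K') \<in> O[at_ioo](\<lambda>_. 1)"
proof -
  have "(\<lambda>\<tau>. (f \<tau> * nome \<tau> powi K) * nome \<tau> powi (K' - K)) \<in> O[at_ioo](\<lambda>_. 1 * 1)"
    using assms by (intro landau_o.big.mult nome_powi_bounded) auto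
  then show ?thesis by (simp add: power_int_diff)
qed

lemma M0_inf_diff:
  assumes "f \<in> M0_inf \<Gamma>" "h \<in> M0_inf \<Gamma>"
  shows "(\<lambda>\<tau>. f \<tau> - c * h \<tau>) \<in> M0_inf \<Gamma>"
proof -
  note f = assms(1)[unfolded M0_inf_iff] and h = assms(2)[unfolded M0_inf_iff]
  obtain K K' where "(\<lambda>\<tau>. f \<tau> * nome \<tau> powi K) \<in> O[at_ioo](\<lambda>_. 1)"
    "(\<lambda>\<tau>. h \<tau> * nome \<tau> powi K') \<in> O[at_ioo](\<lambda>_. 1)"
    using f h by blast
  then have "(\<lambda>\<tau>. f \<tau> * nome \<tau> powi (max K K')) \<in> O[at_ioo](\<lambda>_. 1)"
    "(\<lambda>\<tau>. h \<tau> * nome \<tau> powi (max K K')) \<in> O[at_ioo](\<lambda>_. 1)"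
    using growth_mono[of f K "max K K'"] growth_mono[of h K' "max K K'"] by simp_all
  then have "(\<lambda>\<tau>. f \<tau> * nome \<tau> powi (max K K') - c * (h \<tau> * nome \<tau> powi (max K K'))) \<in> O[at_ioo](\<lambda>_. 1)"
    by (intro sum_in_bigo) (auto simp: landau_o.big.cmult_in_iff)
  then have "(\<lambda>\<tau>. (f \<tau> - c * h \<tau>) * nome \<tau> powi (max K K')) \<in> O[at_ioo](\<lambda>_. 1)"
    by (simp add: algebra_simps)
  moreover have "(\<lambda>\<tau>. f (mobius A \<tau>) - c * h (mobius A \<tau>)) \<in> O[at_ioo](\<lambda>_. 1)"
    if "A \<in> Gamma0 1" "mobius_ext A None \<notin> orbit_of \<Gamma> None" for A
    using f h that by (intro sum_in_bigo) (auto simp: landau_o.big.cmult_in_iff)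
  ultimately show ?thesis
    unfolding M0_inf_iff using f h by (auto intro!: holomorphic_intros)
qed

lemma M0_inf_diff_sum:
  assumes "finite I" "f \<in> M0_inf \<Gamma>" "\<And>i. i \<in> I \<Longrightarrow> h i \<in> M0_inf \<Gamma>"
  shows "(\<lambda>\<tau>. f \<tau> - (\<Sum>i\<in>I. c i * h i \<tau>)) \<in> M0_inf \<Gamma>"
  using assms(1,3)
proof (induction rule: finite_induct)
  case empty
  then show ?case using assms(2) by simp
next
  case (insert i I)
  then have "(\<lambda>\<tau>. (f \<tau> - (\<Sum>i\<in>I. c i * h i \<tau>)) - c i * h i \<tau>) \<in> M0_inf \<Gamma>"
    by (intro M0_inf_diff) auto
  then show ?case using insert by (simp add: algebra_simps)
qed

lemma M0_inf_q_series:
  assumes f: "f \<in> M0_inf \<Gamma>" and L: "has_q_expansion f L"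
  shows "q_series (fls_nth L) f"
proof -
  have hol: "f holomorphic_on upper_half_plane" using f by (simp add: M0_inf_def)
  obtain K where K: "(\<lambda>\<tau>. f \<tau> * nome \<tau> powi K) \<in> O[at_ioo](\<lambda>_. 1)"
    using has_q_expansion_growth[OF L] .
  obtain L' where "has_q_expansion f L'" "q_series (fls_nth L') f"
    using q_expansion_of_periodic[OF hol has_q_expansion_periodic[OF L] K] by blast
  then show ?thesis using has_q_expansion_unique[OF L] by simp
qed

text \<open>Such a function is constant because infinity is not a Weierstrass point. The constant
  itself is not determined, hence the restriction to k \<noteq> 0.\<close>

lemma M0_inf_few_poles_constant:
  assumes f: "f \<in> M0_inf \<Gamma>" and not_W: "\<not> infinity_Weierstrass_point \<Gamma> g"
    and c: "q_series c f" "\<And>k. k < - int g \<Longrightarrow> c k = 0" and "k \<noteq> 0"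
  shows "c k = 0"
proof -
  obtain L where L: "has_q_expansion f L" using f by (auto simp: M0_inf_def)
  have "fls_nth L = c"
    using q_series_unique M0_inf_q_series[OF f L] c(1) by blast
  then have "fls_subdegree L \<ge> - int g"
    using c(2) by (cases "L = 0") (auto intro!: fls_subdegree_geI)
  then have "f constant_on upper_half_plane"
    using not_W f L unfolding infinity_Weierstrass_point_def by blast
  then obtain a where "\<And>\<tau>. \<tau> \<in> upper_half_plane \<Longrightarrow> f \<tau> = a"
    unfolding constant_on_def by blast
  then have "q_series (\<lambda>k. if k = 0 then a else 0) f"
    by (intro q_series_cong[OF q_series_const]) auto
  then have "c = (\<lambda>k. if k = 0 then a else 0)" by (rule q_series_unique[OF c(1)])
  then show ?thesis using \<open>k \<noteq> 0\<close> by simp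
qed

end

section \<open>The Hecke sum as an element of \<open>M0_inf\<close> and its principal part\<close>

context hecke_cusp
begin

lemma hecke_sum_in_M0_inf:
  assumes F: "F \<in> M0_inf \<Gamma>"
  shows "hecke_sum \<in> M0_inf \<Gamma>"
proof -
  obtain K where "(\<lambda>\<tau>. F \<tau> * nome \<tau> powi K) \<in> O[at_ioo](\<lambda>_. 1)"
    using F unfolding M0_inf_iff by blast
  then have K: "(\<lambda>\<tau>. F \<tau> * nome \<tau> powi (max K 0)) \<in> O[at_ioo](\<lambda>_. 1)"
    by (rule growth_mono) simp
  \<comment> \<open>Passing to F(p^r \<tau>) multiplies pole orders by p^r. With
    \<open>max K 0\<close> the exponent is nonnegative, so this power of the nome keeps the
    difference in \<open>hecke_sum_infinity\<close> bounded.\<close>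
  define K' where "K' = int (p ^ r) * max K 0"
  have "(\<lambda>\<tau>. F (mobius (mat2 (real (p ^ r)) 0 0 1) \<tau>) * nome (mobius (mat2 (real (p ^ r)) 0 0 1) \<tau>) powi (max K 0))
      \<in> O[at_ioo](\<lambda>_. 1)"
    by (rule at_ioo_compose_upper_triangular[OF K]) (use p_pos in auto)
  then have "(\<lambda>\<tau>. F (of_nat (p ^ r) * \<tau>) * nome (of_nat (p ^ r) * \<tau>) powi (max K 0)) \<in> O[at_ioo](\<lambda>_. 1)"
    by (simp add: mobius_def)
  then have "(\<lambda>\<tau>. F (of_nat (p ^ r) * \<tau>) * nome \<tau> powi K') \<in> O[at_ioo](\<lambda>_. 1)"
    unfolding nome_mult_nat K'_def by (simp only: power_int_mult power_int_of_nat)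
  moreover have "(\<lambda>\<tau>. (hecke_sum \<tau> - F (of_nat (p ^ r) * \<tau>)) * nome \<tau> powi K') \<in> O[at_ioo](\<lambda>_. 1 * 1)"
    by (intro landau_o.big.mult hecke_sum_infinity nome_powi_bounded) (simp add: K'_def)
  ultimately have "(\<lambda>\<tau>. F (of_nat (p ^ r) * \<tau>) * nome \<tau> powi K' +
      (hecke_sum \<tau> - F (of_nat (p ^ r) * \<tau>)) * nome \<tau> powi K') \<in> O[at_ioo](\<lambda>_. 1)"
    by (intro sum_in_bigo) simp_all
  then have "(\<lambda>\<tau>. hecke_sum \<tau> * nome \<tau> powi K') \<in> O[at_ioo](\<lambda>_. 1)"
    by (simp add: algebra_simps)
  then show ?thesis
    unfolding M0_inf_iff using hecke_sum_holomorphic hecke_sum_invariant hecke_sum_bounded by blast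
qed

text \<open>The difference of the Hecke sum and F(p^r \<tau>) is 1-periodic and bounded, so its
  expansion has no negative exponents; uniqueness of coefficients does the rest.\<close>

lemma hecke_sum_principal_part:
  assumes c: "q_series c F" and e: "q_series e hecke_sum" and "k < 0"
  shows "e k = (if int (p ^ r) dvd k then c (k div int (p ^ r)) else 0)"
proof -
  let ?d = "\<lambda>k. if int (p ^ r) dvd k then c (k div int (p ^ r)) else 0"
  let ?h = "\<lambda>\<tau>. hecke_sum \<tau> - F (of_nat (p ^ r) * \<tau>)"
  have diff: "q_series (\<lambda>k. e k - ?d k) ?h"
    using p_pos by (intro q_series_diff e q_series_dilate c) simp
  have bdd: "(\<lambda>\<tau>. ?h \<tau> * nome \<tau> powi 0) \<in> O[at_ioo](\<lambda>_. 1)"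
    using hecke_sum_infinity by simp
  have hol: "?h holomorphic_on upper_half_plane"
  proof (intro holomorphic_on_diff hecke_sum_holomorphic)
    have "F \<circ> (\<lambda>\<tau>. of_nat (p ^ r) * \<tau>) holomorphic_on upper_half_plane"
      using p_pos by (intro holomorphic_on_compose_gen[OF _ F_hol] holomorphic_intros)
        (auto simp: upper_half_plane_def simp flip: of_nat_power)
    then show "(\<lambda>\<tau>. F (of_nat (p ^ r) * \<tau>)) holomorphic_on upper_half_plane"
      by (simp add: o_def)
  qed
  have per: "?h (\<tau> + 1) = ?h \<tau>" if \<tau>: "\<tau> \<in> upper_half_plane" for \<tau>
  proof -
    have "of_nat (p ^ r) * \<tau> \<in> upper_half_plane"
      using \<tau> p_pos by (simp add: upper_half_plane_def flip: of_nat_power)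
    then show ?thesis
      using translation_invariant[of hecke_sum \<tau> 1, OF hecke_sum_invariant \<tau>]
        translation_invariant[of F "of_nat (p ^ r) * \<tau>" "int (p ^ r)", OF F_inv]
      by (simp add: algebra_simps)
  qed
  obtain L where L: "\<And>k. k < - 0 \<Longrightarrow> fls_nth L k = 0" "q_series (fls_nth L) ?h"
    using q_expansion_of_periodic[OF hol per bdd] by blast
  have "fls_nth L = (\<lambda>k. e k - ?d k)"
    by (rule q_series_unique[OF L(2) diff])
  then have "e k - ?d k = fls_nth L k" by simp
  also have "\<dots> = 0" using L(1)[of k] \<open>k < 0\<close> by simp
  finally have "e k - ?d k = 0" .
  then show ?thesis by simp
qed

end

section \<open>Comparison of the Hecke sum with the reduced functions\<close>

theorem theorem1p11:
  fixes N g p r m n :: nat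
    and S :: "nat set"
    and \<Gamma> :: "(real ^ 2 ^ 2) set"
    and f :: "nat \<Rightarrow> complex \<Rightarrow> complex"
    and a :: "nat \<Rightarrow> int \<Rightarrow> complex"
  assumes "N \<ge> 1"
    and "\<And>Q. Q \<in> S \<Longrightarrow> exact_divisor Q N"
    and "\<Gamma> = N_plus_S N S"
    and "has_genus (modular_curve \<Gamma>) g"
    and "g \<ge> 1"
    and "\<not> infinity_Weierstrass_point \<Gamma> g"
    and "\<And>k. k \<ge> 1 \<Longrightarrow> is_reduced_function \<Gamma> g k (f k) (a k)"
    and "\<And>k j. k \<ge> 1 \<Longrightarrow> (- int g \<le> j \<and> j \<le> - 1) \<or> j \<ge> 1 \<Longrightarrow> a k j \<in> \<int>"
    and "prime p"
    and "p > g"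
    and "r \<ge> 1" and "n \<ge> 1" and "m > g"
    and "\<not> p dvd m" and "\<not> p dvd n"
  shows "\<exists>c::int. a (m * p ^ r) (int n) + (\<Sum>l=1..g. a m (- int l) * a (l * p ^ r) (int n)) = of_int c
           \<and> [c = 0] (mod int p ^ r)"
proof -
  interpret level N S \<Gamma> using assms(1-3) by unfold_locales
  define P where "P = p ^ r"
  have "p > 0" using \<open>prime p\<close> prime_gt_0_nat by blast
  have P: "P \<ge> p" "P > 0"
    using \<open>p > 0\<close> \<open>r \<ge> 1\<close> self_le_power[of p r] by (auto simp: P_def)
  \<comment> \<open>For k > g this is the complete coefficient sequence of \<open>f k\<close>, with
    the leading 1 and the zero constant term.\<close>
  define coeff where "coeff k j = (if j = - int k then 1
      else if (- int g \<le> j \<and> j \<le> - 1) \<or> j \<ge> 1 then a k j else 0)" for k j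
  have f_M0: "f k \<in> M0_inf \<Gamma>" and f_series: "q_series (coeff k) (f k)" if k: "k > g" for k
  proof -
    have "is_reduced_function \<Gamma> g k (f k) (a k)" using assms(7)[of k] k by simp
    then obtain L where L: "f k \<in> M0_inf \<Gamma>" "has_q_expansion (f k) L" "\<And>j. fls_nth L j = coeff k j"
      using k unfolding is_reduced_function_def coeff_def by auto
    show "f k \<in> M0_inf \<Gamma>" by (rule L(1))
    show "q_series (coeff k) (f k)"
      by (rule q_series_cong[OF M0_inf_q_series[OF L(1,2)]]) (simp_all add: L(3))
  qed
  define F where "F = f m"
  have F_M0: "F \<in> M0_inf \<Gamma>" and F_series: "q_series (coeff m) F"
    using f_M0 f_series \<open>m > g\<close> by (simp_all add: F_def)
  \<comment> \<open>Negative exponents with a nonzero coefficient are -m, prime to \<open>p\<close>,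
    or between -g and -1, too small to be multiples of \<open>p\<close> since p > g.\<close>
  have prime_to_p: "coeff m j = 0" if "int p dvd j" "j < 0" for j
  proof -
    have "j \<noteq> - int m" using that \<open>\<not> p dvd m\<close> by (auto simp: int_dvd_int_iff)
    moreover have "int p \<le> - j" using that by (intro zdvd_imp_le) auto
    then have "\<not> (- int g \<le> j \<and> j \<le> - 1)" using \<open>p > g\<close> by linarith
    ultimately show ?thesis using that by (simp add: coeff_def)
  qed
  have trace: "(\<lambda>\<tau>. \<Sum>i<p. F (\<tau> + of_real (real i / real p))) \<in> O[at_ioo](\<lambda>_. 1)"
    by (rule q_series_bounded[OF q_series_trace[OF F_series \<open>p > 0\<close>]]) (simp add: prime_to_p)
  interpret hecke_cusp N S \<Gamma> p r F
    using F_M0 \<open>prime p\<close> trace unfolding M0_inf_iff by unfold_locales auto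
  obtain L where "has_q_expansion hecke_sum L"
    using hecke_sum_in_M0_inf[OF F_M0] by (auto simp: M0_inf_def)
  define e where "e = fls_nth L"
  have e: "q_series e hecke_sum"
    unfolding e_def by (rule M0_inf_q_series[OF hecke_sum_in_M0_inf[OF F_M0]]) fact
  \<comment> \<open>The Hecke sum has the principal part of F(P \<tau>), whose exponents are -m P
    and -l P with 1 \<le> l \<le> g; subtracting the matching reduced functions leaves poles of
    order at most \<open>g\<close>.\<close>
  define H where "H = (\<lambda>\<tau>. hecke_sum \<tau> - f (m * P) \<tau> - (\<Sum>l=1..g. a m (- int l) * f (l * P) \<tau>))"
  \<comment> \<open>These are the coefficients of \<open>H\<close>.\<close>
  define d where "d j = e j - coeff (m * P) j - (\<Sum>l=1..g. a m (- int l) * coeff (l * P) j)" for j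
  \<comment> \<open>As P \<ge> p > g, each \<open>f (l * P)\<close> with l \<ge> 1 is a genuine
    reduced function and not the conventional 0.\<close>
  have big: "l * P > g" if "l \<ge> 1" for l
  proof -
    have "P \<le> l * P" using that by simp
    then show ?thesis using P \<open>p > g\<close> by linarith
  qed
  have m1: "m \<ge> 1" using \<open>m > g\<close> by simp
  have "(\<lambda>\<tau>. (hecke_sum \<tau> - 1 * f (m * P) \<tau>) - (\<Sum>l=1..g. a m (- int l) * f (l * P) \<tau>)) \<in> M0_inf \<Gamma>"
    by (intro M0_inf_diff_sum M0_inf_diff hecke_sum_in_M0_inf F_M0 f_M0 big m1) auto
  then have H: "H \<in> M0_inf \<Gamma>" by (simp add: H_def)
  have d: "q_series d H"
    unfolding H_def d_def
    by (intro q_series_diff q_series_sum q_series_cmult e f_series big m1) auto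
  have "d j = 0" if j: "j < - int g" for j
  proof (cases "int P dvd j")
    case False
    then have "j \<noteq> - int (l * P)" for l by auto
    then have "coeff (l * P) j = 0" for l
      using j by (simp add: coeff_def)
    moreover have "e j = 0"
      using hecke_sum_principal_part[OF F_series e, of j] False j by (simp add: P_def)
    ultimately show ?thesis by (simp add: d_def)
  next
    case True
    then obtain i where i: "j = int P * i" by (auto elim: dvdE)
    have "i < 0"
    proof (rule ccontr)
      assume "\<not> i < 0"
      then have "0 \<le> int P * i" by simp
      then show False using i j by simp
    qed
    define t where "t = nat (- i)"
    have t: "i = - int t" "t \<ge> 1" using \<open>i < 0\<close> by (auto simp: t_def)
    \<comment> \<open>Below -g only the leading term of \<open>f (l * P)\<close>, at exponent -l P,
      is left.\<close>
    have coeff: "coeff (l * P) j = (if l = t then 1 else 0)" for l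
      using j P by (auto simp: coeff_def i t(1) mult.commute)
    have "j div int P = - int t" using P by (simp add: i t(1)[symmetric])
    then have "e j = coeff m (- int t)"
      using hecke_sum_principal_part[OF F_series e, of j, folded P_def] True j by simp
    \<comment> \<open>Because m > g, the cases t = m and t \<le> g exclude each other.\<close>
    also have "\<dots> = (if m = t then 1 else 0) + (if t \<in> {1..g} then a m (- int t) else 0)"
      using t(2) \<open>m > g\<close> by (auto simp: coeff_def)
    also have "(if t \<in> {1..g} then a m (- int t) else 0) = (\<Sum>l=1..g. if l = t then a m (- int l) else 0)"
      by (rule sum.delta[symmetric]) simp
    also have "\<dots> = (\<Sum>l=1..g. a m (- int l) * (if l = t then 1 else 0))"
      by (intro sum.cong refl) simp
    finally show ?thesis by (simp add: d_def coeff)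
  qed
  \<comment> \<open>\<open>H\<close> is constant, so its coefficient at the positive index
    \<open>n\<close> vanishes.\<close>
  then have dn: "d (int n) = 0"
    using M0_inf_few_poles_constant[OF H assms(6) d] \<open>n \<ge> 1\<close> by simp
  have Pn: "1 \<le> int P * int n"
    using P \<open>n \<ge> 1\<close> mult_mono[of 1 "int P" 1 "int n"] by simp
  have "coeff k (int n) = a k (int n)" for k
    using \<open>n \<ge> 1\<close> by (simp add: coeff_def)
  with dn have "a (m * P) (int n) + (\<Sum>l=1..g. a m (- int l) * a (l * P) (int n)) = e (int n)"
    by (simp add: d_def algebra_simps)
  \<comment> \<open>The factor \<open>P\<close>, available because \<open>p\<close> does not divide
    \<open>n\<close>, is the source of the congruence.\<close>
  also have "e (int n) = of_nat P * coeff m (int P * int n)"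
    using hecke_sum_coefficient[OF F_series e, of "int n"] \<open>\<not> p dvd n\<close> by (simp add: P_def)
  also have "coeff m (int P * int n) = a m (int P * int n)"
    using Pn by (simp add: coeff_def)
  finally have main: "a (m * P) (int n) + (\<Sum>l=1..g. a m (- int l) * a (l * P) (int n)) =
      of_nat P * a m (int P * int n)" .
  have "a m (int P * int n) \<in> \<int>" using Pn assms(8)[OF m1] by simp
  then obtain b :: int where "a m (int P * int n) = of_int b" by (rule Ints_cases)
  then have "a (m * P) (int n) + (\<Sum>l=1..g. a m (- int l) * a (l * P) (int n)) = of_int (int P * b)"
    using main by simp
  then show ?thesis
    unfolding P_def by (intro exI[of _ "int (p ^ r) * b"]) (simp add: cong_0_iff)
qed

end
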